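(* Let $\Sigma_0,\Sigma_1\in\mathrm{P}(n)$. The lifted relative entropy $F$ restricted to $K=\mathrm{P}(n)\subset\mathrm{GL}(n)$ admits a unique maximum $P_\infty\in K$. It fulfills $$P_\infty\Sigma_0P_\infty=\Sigma_1 .$$ Furthermore, for any initial data $P(0)\in K$, the lifted gradient flow $$\dot P=P^{-1}\Sigma_0^{-1}-\Sigma_1^{-1}P+V,$$ where $V=V(P)$ is the solution of the Sylvester equation $$\Sigma_0V+V\Sigma_0=\Sigma_0\left(\Sigma_0^{-1}P^{-1}-P^{-1}\Sigma_0^{-1}+\Sigma_1^{-1}P-P\Sigma_1^{-1}\right),$$ converges towards $P_\infty$ as $t\to\infty$, with the estimates $$F(P(t))\ge e^{-2\alpha t}F(P(0))\quad\text{and}\quad d^2(P(t),P_\infty)\le e^{-2\alpha t}d^2(P(0),P_\infty),$$ where $\alpha>0$ is a constant (such constants exist) for which $$-\mathrm{Hess}(F|_K)_P(\dot P,\dot P)\ge\alpha\,\mathcal G_P(\dot P,\dot P)\qquad\text{for all }(P,\dot P)\in TK.$$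
   Context: All matrices are real $n\times n$; $\mathrm{P}(n)$ is the set of symmetric positive definite matrices and $\mathrm{S}(n)$ the space of symmetric matrices. $\mathrm{GL}(n)$ carries the flat Riemannian metric $\mathcal G_A(\dot A,\dot A)=\operatorname{tr}(\Sigma_0\dot A^\top\dot A)$, with distance function given by $d^2(A_0,A_1)=\operatorname{tr}(\Sigma_0(A_0-A_1)^\top(A_0-A_1))$. The polar cone is $K=\mathrm{P}(n)$, viewed as a submanifold of $\mathrm{GL}(n)$ with tangent spaces $T_PK=\mathrm{S}(n)$ and the restricted metric; $\mathrm{Hess}(F|_K)$ is the Riemannian Hessian of $F|_K$ with respect to this restricted metric (regarded as a quadratic form). The lifted relative entropy is $$F(A)=\frac n2-\frac12\operatorname{tr}(\Sigma_1^{-1}A\Sigma_0A^\top)+\frac12\log\det(\Sigma_1^{-1}A\Sigma_0A^\top),\qquad A\in\mathrm{GL}(n).$$ The lifted gradient flow is the flow $\dot P=\Pi_P\nabla_{\mathcal G}F(P)$ on $K$, where $\Pi_P$ is the $\mathcal G$-orthogonal projection onto $T_PK$; the displayed equation is its explicit form. *)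

theory Defs
  imports "HOL-Analysis.Analysis"
begin

definition Sym :: "(real^'n^'n) set" where
  "Sym = {A. transpose A = A}"

definition SPD :: "(real^'n^'n) set" where
  "SPD = {A. transpose A = A \<and> (\<forall>x. x \<noteq> 0 \<longrightarrow> x \<bullet> (A *v x) > 0)}"

text \<open>The parameters \<open>S0\<close>, \<open>S1\<close> stand for the matrices \<open>\<Sigma>\<^sub>0\<close>, \<open>\<Sigma>\<^sub>1\<close>.  The metric is flat (it does
  not depend on the base point); it is given here in polarised form.\<close>

definition lift_metric :: "real^'n^'n \<Rightarrow> real^'n^'n \<Rightarrow> real^'n^'n \<Rightarrow> real" where
  "lift_metric S0 X Y = trace (S0 ** transpose X ** Y)"

definition lift_dist :: "real^'n^'n \<Rightarrow> real^'n^'n \<Rightarrow> real^'n^'n \<Rightarrow> real" where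
  "lift_dist S0 A B = sqrt (trace (S0 ** transpose (A - B) ** (A - B)))"

definition lift_entropy :: "real^'n^'n \<Rightarrow> real^'n^'n \<Rightarrow> real^'n^'n \<Rightarrow> real" where
  "lift_entropy S0 S1 A =
     real CARD('n) / 2
     - 1/2 * trace (matrix_inv S1 ** A ** S0 ** transpose A)
     + 1/2 * ln (det (matrix_inv S1 ** A ** S0 ** transpose A))"

definition lift_grad ::
  "real^'n^'n \<Rightarrow> (real^'n^'n \<Rightarrow> real) \<Rightarrow> real^'n^'n \<Rightarrow> real^'n^'n" where
  "lift_grad S0 f A = (THE X. (f has_derivative lift_metric S0 X) (at A))"

text \<open>The orthogonal projection onto the tangent space \<open>T\<^sub>PK = Sym\<close> of the polar cone \<open>K = SPD\<close>;
  neither the metric nor the tangent space depends on the base point \<open>P\<close>.\<close>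

definition tangent_proj :: "real^'n^'n \<Rightarrow> real^'n^'n \<Rightarrow> real^'n^'n" where
  "tangent_proj S0 X = (THE Y. Y \<in> Sym \<and> (\<forall>H\<in>Sym. lift_metric S0 (X - Y) H = 0))"

text \<open>The Riemannian gradient of the restriction of \<open>f\<close> to the submanifold \<open>SPD\<close>.\<close>

definition cone_grad ::
  "real^'n^'n \<Rightarrow> (real^'n^'n \<Rightarrow> real) \<Rightarrow> real^'n^'n \<Rightarrow> real^'n^'n" where
  "cone_grad S0 f P = tangent_proj S0 (lift_grad S0 f P)"

text \<open>The Levi-Civita derivative of a vector field \<open>Y\<close> on \<open>SPD\<close> in the direction \<open>X\<close>: the tangential
  projection of the flat ambient derivative.  The derivative is taken along \<open>s \<mapsto> P + s X\<close>, which
  stays in \<open>SPD\<close> for small \<open>s\<close> if \<open>P \<in> SPD\<close> and \<open>X \<in> Sym\<close>.\<close>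

definition cone_cov_deriv ::
  "real^'n^'n \<Rightarrow> (real^'n^'n \<Rightarrow> real^'n^'n) \<Rightarrow> real^'n^'n \<Rightarrow> real^'n^'n \<Rightarrow> real^'n^'n" where
  "cone_cov_deriv S0 Y P X =
     tangent_proj S0 (vector_derivative (\<lambda>s::real. Y (P + s *\<^sub>R X)) (at 0))"

definition cone_hess ::
  "real^'n^'n \<Rightarrow> (real^'n^'n \<Rightarrow> real) \<Rightarrow> real^'n^'n \<Rightarrow> real^'n^'n \<Rightarrow> real^'n^'n \<Rightarrow> real" where
  "cone_hess S0 f P X Y = lift_metric S0 (cone_cov_deriv S0 (cone_grad S0 f) P X) Y"

definition hess_bound :: "real^'n^'n \<Rightarrow> real^'n^'n \<Rightarrow> real \<Rightarrow> bool" where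
  "hess_bound S0 S1 \<alpha> \<longleftrightarrow>
     (\<forall>P\<in>SPD. \<forall>X\<in>Sym. - cone_hess S0 (lift_entropy S0 S1) P X X \<ge> \<alpha> * lift_metric S0 X X)"

definition sylvester :: "real^'n^'n \<Rightarrow> real^'n^'n \<Rightarrow> real^'n^'n \<Rightarrow> real^'n^'n \<Rightarrow> bool" where
  "sylvester S0 S1 P V \<longleftrightarrow>
     S0 ** V + V ** S0 =
     S0 ** (matrix_inv S0 ** matrix_inv P - matrix_inv P ** matrix_inv S0
            + matrix_inv S1 ** P - P ** matrix_inv S1)"

definition flow_field :: "real^'n^'n \<Rightarrow> real^'n^'n \<Rightarrow> real^'n^'n \<Rightarrow> real^'n^'n" where
  "flow_field S0 S1 P =
     matrix_inv P ** matrix_inv S0 - matrix_inv S1 ** P + (THE V. sylvester S0 S1 P V)"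

text \<open>A forward trajectory of the flow, defined for all times \<open>t \<ge> 0\<close>; the values of \<open>P\<close> at
  negative times are irrelevant.\<close>

definition flow_solution ::
  "real^'n^'n \<Rightarrow> real^'n^'n \<Rightarrow> real^'n^'n \<Rightarrow> (real \<Rightarrow> real^'n^'n) \<Rightarrow> bool" where
  "flow_solution S0 S1 P0 P \<longleftrightarrow>
     P 0 = P0 \<and>
     (\<forall>t\<ge>0. P t \<in> SPD \<and>
        (P has_vector_derivative flow_field S0 S1 (P t)) (at t within {0..}))"

end

theory Submission
  imports Defs
begin

text \<open>On the cone the Hessian of the lifted entropy is explicitly
  \<open>- Hess (X, X) = tr (P\<^sup>-\<^sup>1 X P\<^sup>-\<^sup>1 X) + tr (\<Sigma>\<^sub>0 X \<Sigma>\<^sub>1\<^sup>-\<^sup>1 X)\<close>, whose second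
  summand does not depend on \<open>P\<close> and is positive definite; so the entropy is uniformly concave.
  Its maximal value is \<open>0\<close>, by \<open>ln det B \<le> tr B - n\<close> for a positive definite matrix \<open>B\<close> similar to
  \<open>\<Sigma>\<^sub>1\<^sup>-\<^sup>1 P \<Sigma>\<^sub>0 P\<close>, and it is attained exactly where \<open>P \<Sigma>\<^sub>0 P = \<Sigma>\<^sub>1\<close>.
  The two estimates are the gradient domination inequality and the strong monotonicity
  that follow from uniform concavity.  Trajectories exist for all times because the
  superlevel sets are compact and convex.\<close>

section \<open>Matrix algebra and positive definite matrices\<close>

text \<open>The metric pairs \<open>X ** S0\<close> with \<open>Y\<close> in the Frobenius inner
  product, so tangential projection is in general not symmetrization: the residual
  \<open>(X - Y) ** S0\<close> must be skew, which is a Sylvester equation for \<open>Y\<close>. The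
  Sylvester equation of the flow has the same origin: \<open>V\<close> is the correction that makes
  the ambient gradient tangent. Neither the metric nor the projection depends on the base point and
  the cone is convex, so geodesics are segments and the Hessian bound is integrated along them by
  one-variable calculus. The estimates are proved for every positive constant in the Hessian bound;
  the existence of such a constant is a separate fact. The obstacle is global existence.
  \<open>matrix_inv P\<close> blows up at the boundary of the cone, so a Lipschitz constant is
  sought on a superlevel set of the entropy only. The logarithm of the determinant keeps such a set
  away from singular matrices, and strong concavity bounds it.\<close>

interpretation matrix_mult: bounded_bilinear
  "(**) :: real^'n^'m \<Rightarrow> real^'p^'n \<Rightarrow> real^'p^'m"
proof (subst bilinear_conv_bounded_bilinear[symmetric])
  show "bilinear ((**) :: real^'n^'m \<Rightarrow> real^'p^'n \<Rightarrow> real^'p^'m)"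
    by (auto simp: bilinear_def linear_iff vec_eq_iff matrix_matrix_mult_def
        algebra_simps sum.distrib sum_distrib_left)
qed

lemma bounded_linear_transpose: "bounded_linear (transpose :: real^'n^'m \<Rightarrow> real^'m^'n)"
  by (subst linear_conv_bounded_linear[symmetric]) (auto simp: linear_iff transpose_def vec_eq_iff)

lemma transpose_add: "transpose (A + B) = transpose A + transpose (B :: real^'n^'m)"
  by (rule linear_add[OF bounded_linear.linear[OF bounded_linear_transpose]])

lemma transpose_diff: "transpose (A - B) = transpose A - transpose (B :: real^'n^'m)"
  by (rule linear_diff[OF bounded_linear.linear[OF bounded_linear_transpose]])

lemma transpose_0: "transpose (0 :: real^'n^'m) = 0"
  by (rule linear_0[OF bounded_linear.linear[OF bounded_linear_transpose]])

section \<open>Adjoints in the Frobenius inner product, positive definiteness\<close>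

lemma inner_matrix_transpose: "transpose A \<bullet> transpose B = (A::real^'n^'m) \<bullet> B"
  unfolding inner_vec_def transpose_def by (simp, subst sum.swap) simp

lemma inner_matrix_mult_left: "(A ** B) \<bullet> C = B \<bullet> (transpose A ** C)"
  for A :: "real^'n^'m" and B :: "real^'p^'n"
proof -
  have "(A ** B) \<bullet> C = (\<Sum>i\<in>UNIV. \<Sum>j\<in>UNIV. \<Sum>k\<in>UNIV. A$i$k * B$k$j * C$i$j)"
    by (simp add: inner_vec_def matrix_matrix_mult_def sum_distrib_right)
  also have "\<dots> = (\<Sum>i\<in>UNIV. \<Sum>k\<in>UNIV. \<Sum>j\<in>UNIV. A$i$k * B$k$j * C$i$j)"
    by (intro sum.cong refl sum.swap)
  also have "\<dots> = (\<Sum>k\<in>UNIV. \<Sum>i\<in>UNIV. \<Sum>j\<in>UNIV. A$i$k * B$k$j * C$i$j)"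
    by (rule sum.swap)
  also have "\<dots> = (\<Sum>k\<in>UNIV. \<Sum>j\<in>UNIV. \<Sum>i\<in>UNIV. A$i$k * B$k$j * C$i$j)"
    by (intro sum.cong refl sum.swap)
  also have "\<dots> = B \<bullet> (transpose A ** C)"
    by (simp add: inner_vec_def matrix_matrix_mult_def transpose_def sum_distrib_left mult_ac)
  finally show ?thesis .
qed

lemma inner_matrix_mult_right: "(A ** B) \<bullet> C = A \<bullet> (C ** transpose B)"
  for A :: "real^'n^'m" and B :: "real^'p^'n"
proof -
  have "(A ** B) \<bullet> C = (transpose B ** transpose A) \<bullet> transpose C"
    by (simp flip: matrix_transpose_mul add: inner_matrix_transpose)
  also have "\<dots> = transpose A \<bullet> (B ** transpose C)"
    by (simp add: inner_matrix_mult_left)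
  also have "\<dots> = transpose A \<bullet> transpose (C ** transpose B)"
    by (simp add: matrix_transpose_mul)
  finally show ?thesis by (simp add: inner_matrix_transpose)
qed

lemma trace_matrix_mult_inner: "trace (A ** B) = transpose A \<bullet> (B :: real^'n^'n)"
proof -
  have "trace (A ** B) = (\<Sum>i\<in>UNIV. \<Sum>k\<in>UNIV. A$i$k * B$k$i)"
    by (simp add: trace_def matrix_matrix_mult_def)
  also have "\<dots> = (\<Sum>k\<in>UNIV. \<Sum>i\<in>UNIV. A$i$k * B$k$i)"
    by (rule sum.swap)
  finally show ?thesis by (simp add: inner_vec_def transpose_def)
qed

lemma SPD_imp_Sym: "A \<in> SPD \<Longrightarrow> A \<in> Sym"
  by (simp add: SPD_def Sym_def)

lemma transpose_Sym: "A \<in> Sym \<Longrightarrow> transpose A = A"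
  by (simp add: Sym_def)

lemma transpose_SPD: "A \<in> SPD \<Longrightarrow> transpose A = A"
  by (simp add: SPD_def)

lemma SPD_pos: "A \<in> SPD \<Longrightarrow> x \<noteq> 0 \<Longrightarrow> x \<bullet> (A *v x) > 0"
  by (simp add: SPD_def)

lemma subspace_Sym: "subspace Sym"
  by (auto simp: subspace_def Sym_def transpose_0 transpose_add transpose_scalar)

lemma Sym_inner_sym: "A \<in> Sym \<Longrightarrow> (A *v x) \<bullet> y = x \<bullet> (A *v y)"
  by (metis dot_lmul_matrix transpose_Sym transpose_matrix_vector)

lemma matrix_mult_row: "(A ** B) $ i = A $ i v* B"
  by (simp add: matrix_matrix_mult_def vector_matrix_mult_def vec_eq_iff mult.commute)

text \<open>Row by row, the pairing splits into the forms \<open>X$i \<bullet> (S *v X$i)\<close>.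
  This sum gives both the positivity of the metric and the injectivity of the Sylvester
  operator.\<close>

lemma inner_mult_SPD_pos:
  assumes "S \<in> SPD" "X \<noteq> 0" shows "(X ** S) \<bullet> X > 0"
proof -
  have "(X ** S) \<bullet> X = (\<Sum>i\<in>UNIV. X$i \<bullet> (S *v X$i))"
    unfolding inner_vec_def[of "X ** S"] matrix_mult_row dot_lmul_matrix ..
  moreover obtain i where "X $ i \<noteq> 0" using assms(2) by (auto simp: vec_eq_iff)
  moreover have "X$i \<bullet> (S *v X$i) \<ge> 0" for i
    using SPD_pos[OF assms(1), of "X$i"] by (cases "X$i = 0") auto
  ultimately show ?thesis using SPD_pos[OF assms(1)] by (auto intro!: sum_pos2)
qed

lemma matrix_inv_mult:
  fixes A :: "real^'n^'n" assumes "invertible A"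
  shows "A ** matrix_inv A = mat 1" "matrix_inv A ** A = mat 1"
  using someI_ex[OF assms[unfolded invertible_def]] unfolding matrix_inv_def by auto

lemma matrix_inv_eqI:
  fixes A :: "real^'n^'n" assumes "A ** B = mat 1" shows "matrix_inv A = B"
proof -
  have "invertible A" using assms matrix_left_right_inverse invertible_def by blast
  thus ?thesis
    by (metis assms matrix_inv_mult(2) matrix_mul_assoc matrix_mul_lid matrix_mul_rid)
qed

lemma matrix_inv_cancel:
  fixes A :: "real^'n^'n" assumes "invertible A"
  shows "A ** (matrix_inv A ** B) = B" "matrix_inv A ** (A ** B) = B"
  by (simp_all add: matrix_mul_assoc matrix_inv_mult[OF assms])

lemma transpose_matrix_inv:
  fixes A :: "real^'n^'n" assumes "invertible A"
  shows "matrix_inv (transpose A) = transpose (matrix_inv A)"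
  by (metis assms matrix_inv_eqI matrix_inv_mult(2) matrix_transpose_mul transpose_mat)

lemma SPD_invertible: assumes "A \<in> SPD" shows "invertible A"
proof -
  have "x = 0" if "A *v x = 0" for x
    using SPD_pos[OF assms, of x] that by fastforce
  thus ?thesis
    by (meson matrix_left_invertible_ker invertible_def matrix_left_right_inverse)
qed

lemma SPD_matrix_inv: assumes "A \<in> SPD" shows "matrix_inv A \<in> SPD"
proof -
  have sym: "transpose (matrix_inv A) = matrix_inv A"
    using transpose_matrix_inv[OF SPD_invertible[OF assms]] assms by (simp add: transpose_SPD)
  have "x \<bullet> (matrix_inv A *v x) > 0" if "x \<noteq> 0" for x
  proof -
    define y where "y = matrix_inv A *v x"
    have x: "A *v y = x"
      unfolding y_def using matrix_inv_mult[OF SPD_invertible[OF assms]]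
      by (simp add: matrix_vector_mul_assoc)
    have "y \<bullet> (A *v y) > 0" using that x by (intro SPD_pos[OF assms]) fastforce
    thus ?thesis unfolding x unfolding y_def by (simp only: inner_commute)
  qed
  thus ?thesis using sym by (simp add: SPD_def)
qed

lemma SPD_congruence:
  fixes A C :: "real^'n^'n" assumes "A \<in> SPD" "invertible C"
  shows "C ** A ** transpose C \<in> SPD"
proof -
  have "x \<bullet> ((C ** A ** transpose C) *v x) > 0" if "x \<noteq> 0" for x
  proof -
    have "transpose C *v x \<noteq> 0"
    proof
      assume "transpose C *v x = 0"
      hence "transpose (matrix_inv C) *v (transpose C *v x) = 0" by simp
      hence "x = 0" by (simp only: matrix_vector_mul_assoc flip: matrix_transpose_mul)
          (simp add: matrix_inv_mult[OF assms(2)])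
      with that show False ..
    qed
    moreover have "x \<bullet> ((C ** A ** transpose C) *v x)
        = (transpose C *v x) \<bullet> (A *v (transpose C *v x))"
      by (simp flip: matrix_vector_mul_assoc add: dot_lmul_matrix)
    ultimately show ?thesis using SPD_pos[OF assms(1)] by simp
  qed
  thus ?thesis using assms(1) by (simp add: SPD_def matrix_transpose_mul matrix_mul_assoc)
qed

text \<open>The constant is the minimum of the form on the compact unit sphere, carried to all
  vectors by homogeneity. It is applied to the metric, to the constant part of the Hessian, and to a
  single positive definite matrix.\<close>

lemma positive_form_coercive:
  fixes T :: "'a::euclidean_space \<Rightarrow> 'a"
  assumes T: "linear T" and pos: "\<And>x. x \<noteq> 0 \<Longrightarrow> T x \<bullet> x > 0"
  obtains \<mu> where "\<mu> > 0" "\<And>x. T x \<bullet> x \<ge> \<mu> * (norm x)\<^sup>2"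
proof -
  have cont: "continuous_on (sphere 0 1) (\<lambda>x. T x \<bullet> x)"
    by (intro continuous_intros linear_continuous_on) (simp add: T linear_conv_bounded_linear[symmetric])
  have "sphere (0::'a) 1 \<noteq> {}" by simp
  from continuous_attains_inf[OF compact_sphere this cont]
  obtain v where v: "v \<in> sphere 0 1" "\<And>x. x \<in> sphere 0 1 \<Longrightarrow> T v \<bullet> v \<le> T x \<bullet> x" by auto
  show ?thesis
  proof
    show "T v \<bullet> v > 0" using v(1) by (intro pos) auto
    fix x
    show "T x \<bullet> x \<ge> (T v \<bullet> v) * (norm x)\<^sup>2"
    proof (cases "x = 0")
      case False
      have "T v \<bullet> v \<le> T (x /\<^sub>R norm x) \<bullet> (x /\<^sub>R norm x)" using False by (intro v(2)) simp
      also have "\<dots> = T x \<bullet> x / (norm x)\<^sup>2"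
        by (simp add: linear_cmul[OF T] power2_eq_square divide_simps)
      finally show ?thesis using False by (simp add: pos_le_divide_eq)
    qed (simp add: linear_0[OF T])
  qed
qed

text \<open>The equality case of Cauchy-Schwarz for a semidefinite form: a null vector minimises the
  form on \<open>W\<close>, so the first variation in every direction of \<open>W\<close>
  vanishes.\<close>

lemma nonneg_form_null_imp_orthogonal:
  fixes T :: "'a::real_inner \<Rightarrow> 'a"
  assumes T: "linear T" and W: "subspace W"
    and sym: "\<And>x y. x \<in> W \<Longrightarrow> y \<in> W \<Longrightarrow> T x \<bullet> y = x \<bullet> T y"
    and nonneg: "\<And>x. x \<in> W \<Longrightarrow> T x \<bullet> x \<ge> 0"
    and v: "v \<in> W" "T v \<bullet> v = 0" and w: "w \<in> W"
  shows "T v \<bullet> w = 0"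
proof (rule ccontr)
  assume ne: "T v \<bullet> w \<noteq> 0"
  define b c where "b = T v \<bullet> w" and "c = T w \<bullet> w"
  have *: "0 \<le> 2 * t * b + t\<^sup>2 * c" for t
  proof -
    have "v + t *\<^sub>R w \<in> W" using W v(1) w by (simp add: subspace_add subspace_scale)
    hence "0 \<le> T (v + t *\<^sub>R w) \<bullet> (v + t *\<^sub>R w)" by (rule nonneg)
    also have "\<dots> = 2 * t * b + t\<^sup>2 * c"
      using v(2) sym[OF w v(1)] unfolding b_def c_def
      by (simp add: linear_add[OF T] linear_cmul[OF T] algebra_simps power2_eq_square inner_commute)
    finally show ?thesis .
  qed
  have c: "c \<ge> 0" using nonneg[OF w] by (simp add: c_def)
  \<comment> \<open>The minimising \<open>t\<close> would be \<open>- b / c\<close>, but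
    \<open>c\<close> may be zero; the denominator \<open>c + 1\<close> avoids this and still makes
    the value negative.\<close>
  have "0 \<le> 2 * (- b / (c + 1)) * b + (- b / (c + 1))\<^sup>2 * c" by (rule *)
  also have "\<dots> = b\<^sup>2 * (- (c + 2)) / (c + 1)\<^sup>2"
    using c by (simp add: power2_eq_square divide_simps) (simp add: algebra_simps)
  also have "\<dots> < 0" using c ne unfolding b_def[symmetric]
    by (intro divide_neg_pos mult_pos_neg) auto
  finally show False by simp
qed

section \<open>The spectral theorem\<close>

text \<open>\<open>v\<close> maximises the Rayleigh quotient on the unit sphere of \<open>W\<close>.
  With \<open>c\<close> the maximum, the form of \<open>c - A\<close> is nonnegative on
  \<open>W\<close> and vanishes at \<open>v\<close>, so \<open>T v\<close> is orthogonal to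
  \<open>W\<close>; by invariance it also lies in \<open>W\<close>.\<close>

lemma Sym_eigenvector_in_subspace:
  fixes A :: "real^'n^'n"
  assumes A: "A \<in> Sym" and W: "subspace W" "W \<noteq> {0}" and inv: "\<And>x. x \<in> W \<Longrightarrow> A *v x \<in> W"
  obtains v c where "v \<in> W" "norm v = 1" "A *v v = c *\<^sub>R v"
proof -
  let ?S = "W \<inter> sphere 0 1"
  have cpt: "compact ?S"
    using closed_subspace[OF W(1)] by (metis closed_Int_compact compact_sphere)
  obtain w where w: "w \<in> W" "w \<noteq> 0" using W subspace_0 by fastforce
  have "w /\<^sub>R norm w \<in> ?S" using w subspace_scale[OF W(1)] by simp
  hence ne: "?S \<noteq> {}" by blast
  have "continuous_on ?S (\<lambda>x. (A *v x) \<bullet> x)"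
    by (intro continuous_intros linear_continuous_on)
       (simp add: linear_conv_bounded_linear[symmetric])
  from continuous_attains_sup[OF cpt ne this] obtain v
    where v: "v \<in> W" "norm v = 1" "\<And>x. x \<in> W \<Longrightarrow> norm x = 1 \<Longrightarrow> (A *v x) \<bullet> x \<le> (A *v v) \<bullet> v"
    by auto
  define c where "c = (A *v v) \<bullet> v"
  define T where "T = (\<lambda>x. c *\<^sub>R x - A *v x)"
  have linT: "linear T" unfolding T_def
    by (intro linear_compose_sub linear_scaleR linear_scale_self) auto
  have "T v \<bullet> w = 0" if "w \<in> W" for w
  proof (rule nonneg_form_null_imp_orthogonal[OF linT W(1) _ _ v(1) _ that])
    show "T v \<bullet> v = 0"
      using v(2) by (simp add: T_def inner_diff c_def flip: power2_norm_eq_inner)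
  next
    fix x y assume "x \<in> W" "y \<in> W"
    show "T x \<bullet> y = x \<bullet> T y"
      by (simp add: T_def inner_diff Sym_inner_sym[OF A])
  next
    fix x assume x: "x \<in> W"
    show "T x \<bullet> x \<ge> 0"
    proof (cases "x = 0")
      case False
      have "(A *v (x /\<^sub>R norm x)) \<bullet> (x /\<^sub>R norm x) \<le> c"
        unfolding c_def using False x by (intro v(3)) (simp_all add: subspace_scale[OF W(1)])
      hence "(A *v x) \<bullet> x / (norm x)\<^sup>2 \<le> c"
        by (simp add: matrix_vector_mult_scaleR power2_eq_square divide_simps)
      hence "(A *v x) \<bullet> x \<le> c * (norm x)\<^sup>2" using False by (simp add: pos_divide_le_eq)
      thus ?thesis by (simp add: T_def inner_diff power2_norm_eq_inner)
    qed (simp add: T_def)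
  qed
  moreover have "T v \<in> W"
    unfolding T_def by (intro subspace_diff[OF W(1)] subspace_scale[OF W(1)] v(1) inv)
  ultimately have "T v = 0" by (metis inner_eq_zero_iff)
  hence "A *v v = c *\<^sub>R v" by (simp add: T_def)
  with v that show ?thesis by blast
qed

text \<open>The induction adds an eigenvector found in the orthogonal complement of those already
  chosen. The complement is invariant because \<open>A\<close> is symmetric, and nonzero because
  \<open>k\<close> is below the dimension.\<close>

lemma Sym_orthonormal_eigenvectors:
  fixes A :: "real^'n^'n"
  assumes A: "A \<in> Sym" and "k \<le> CARD('n)"
  shows "\<exists>B. finite B \<and> card B = k \<and> pairwise orthogonal B \<and>
    (\<forall>b\<in>B. norm b = 1 \<and> (\<exists>c. A *v b = c *\<^sub>R b))"
  using assms(2)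
proof (induction k)
  case 0
  show ?case by (intro exI[of _ "{}"]) simp
next
  case (Suc k)
  then obtain B where B: "finite B" "card B = k" "pairwise orthogonal B"
    "\<And>b. b \<in> B \<Longrightarrow> norm b = 1" "\<And>b. b \<in> B \<Longrightarrow> \<exists>c. A *v b = c *\<^sub>R b" by auto
  let ?W = "{x. \<forall>b\<in>B. orthogonal x b}"
  have W: "subspace ?W"
    by (auto simp: subspace_def orthogonal_def inner_add_left)
  have "dim B < DIM(real^'n)"
    using dim_le_card'[OF B(1)] B(2) Suc.prems by simp
  then obtain x where "x \<noteq> 0" "\<And>y. y \<in> span B \<Longrightarrow> orthogonal x y"
    using orthogonal_to_subspace_exists by blast
  hence "x \<in> ?W" "x \<noteq> 0" by (auto intro: span_base)
  hence W0: "?W \<noteq> {0}" by blast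
  have inv: "A *v x \<in> ?W" if "x \<in> ?W" for x
  proof safe
    fix b assume b: "b \<in> B"
    then obtain c where c: "A *v b = c *\<^sub>R b" using B(5) by blast
    have "(A *v x) \<bullet> b = x \<bullet> (A *v b)" by (rule Sym_inner_sym[OF A])
    also have "\<dots> = 0" using that b c by (simp add: orthogonal_def)
    finally show "orthogonal (A *v x) b" by (simp add: orthogonal_def)
  qed
  obtain v c where v: "v \<in> ?W" "norm v = 1" "A *v v = c *\<^sub>R v"
    by (rule Sym_eigenvector_in_subspace[OF A W W0 inv])
  have "v \<notin> B"
  proof
    assume "v \<in> B"
    hence "orthogonal v v" using v(1) by blast
    thus False using v(2) by (simp add: orthogonal_def)
  qed
  thus ?case using B v
    by (intro exI[of _ "insert v B"]) (auto simp: pairwise_insert orthogonal_commute)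
qed

section \<open>Diagonalisation, square roots, and the bound on the log-determinant\<close>

definition diag_matrix :: "('n \<Rightarrow> real) \<Rightarrow> real^'n^'n" where
  "diag_matrix d = (\<chi> i j. if i = j then d i else 0)"

lemma mult_diag_matrix: "(A ** diag_matrix d) $ i $ j = A $ i $ j * d j"
  by (simp add: matrix_matrix_mult_def diag_matrix_def if_distrib cong: if_cong)

lemma diag_matrix_mult_vec: "(diag_matrix d *v x) $ i = d i * x $ i"
  by (simp add: matrix_vector_mult_def diag_matrix_def if_distrib if_distribR cong: if_cong)

lemma det_diag_matrix: "det (diag_matrix d :: real^'n^'n) = prod d UNIV"
  by (subst det_diagonal) (simp_all add: diag_matrix_def)

lemma trace_diag_matrix: "trace (diag_matrix d :: real^'n^'n) = sum d UNIV"
  by (simp add: trace_def diag_matrix_def)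

theorem spectral_theorem_Sym:
  fixes A :: "real^'n^'n"
  assumes A: "A \<in> Sym"
  obtains Q d where "orthogonal_matrix Q" "A = Q ** diag_matrix d ** transpose Q"
    "\<And>j. A *v column j Q = d j *\<^sub>R column j Q"
proof -
  obtain B where B: "finite B" "card B = CARD('n)" "pairwise orthogonal B"
    "\<And>b. b \<in> B \<Longrightarrow> norm b = 1" "\<And>b. b \<in> B \<Longrightarrow> \<exists>c. A *v b = c *\<^sub>R b"
    using Sym_orthonormal_eigenvectors[OF A le_refl] by blast
  then obtain f where f: "bij_betw f (UNIV::'n set) B"
    by (metis finite_class.finite_UNIV finite_same_card_bij)
  define Q where "Q = (\<chi> i j. f j $ i)"
  have fB: "f j \<in> B" for j using f by (auto simp: bij_betw_def)
  have col: "column j Q = f j" for j by (simp add: Q_def column_def)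
  obtain d where d: "\<And>j. A *v f j = d j *\<^sub>R f j" using B(5)[OF fB] by metis
  have "orthogonal_matrix Q"
    unfolding orthogonal_matrix_orthonormal_columns col
  proof safe
    fix i j :: 'n assume "i \<noteq> j"
    thus "orthogonal (f i) (f j)"
      using B(3) fB f by (metis bij_betw_def inj_onD pairwiseD UNIV_I)
  qed (use B(4) fB in blast)
  moreover have "A ** Q = Q ** diag_matrix d"
  proof -
    have "(A ** Q) $ i $ j = (Q ** diag_matrix d) $ i $ j" for i j
    proof -
      have "(A ** Q) $ i $ j = (A *v f j) $ i"
        by (simp add: matrix_matrix_mult_def matrix_vector_mult_def Q_def)
      thus ?thesis by (simp add: d mult_diag_matrix Q_def)
    qed
    thus ?thesis by (simp add: vec_eq_iff)
  qed
  hence "A ** (Q ** transpose Q) = Q ** diag_matrix d ** transpose Q"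
    by (simp add: matrix_mul_assoc)
  hence "A = Q ** diag_matrix d ** transpose Q"
    using \<open>orthogonal_matrix Q\<close> by (simp add: orthogonal_matrix_def)
  ultimately show ?thesis using d that by (metis col)
qed

lemma spectral_theorem_SPD:
  fixes A :: "real^'n^'n"
  assumes A: "A \<in> SPD"
  obtains Q d where "orthogonal_matrix Q" "A = Q ** diag_matrix d ** transpose Q" "\<And>j. d j > 0"
proof -
  obtain Q d where Q: "orthogonal_matrix Q" "A = Q ** diag_matrix d ** transpose Q"
    "\<And>j. A *v column j Q = d j *\<^sub>R column j Q"
    using spectral_theorem_Sym[OF SPD_imp_Sym[OF A]] by blast
  have "d j > 0" for j
  proof -
    have n: "norm (column j Q) = 1" using Q(1) by (simp add: orthogonal_matrix_orthonormal_columns)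
    hence "column j Q \<bullet> (A *v column j Q) > 0" by (intro SPD_pos[OF A]) auto
    thus ?thesis unfolding Q(3) using n by (simp add: norm_eq_1)
  qed
  with Q that show ?thesis by blast
qed

lemma diag_matrix_SPD: assumes "\<And>j. d j > 0" shows "diag_matrix d \<in> SPD"
proof -
  have "x \<bullet> (diag_matrix d *v x) > 0" if x: "x \<noteq> 0" for x
  proof -
    obtain i where "x $ i \<noteq> 0" using x by (auto simp: vec_eq_iff)
    hence "0 < x $ i * (d i * x $ i)" using assms[of i]
      by (metis mult.left_commute mult_pos_pos not_real_square_gt_zero)
    moreover have "0 \<le> x $ j * (d j * x $ j)" for j using assms[of j]
      by (metis less_imp_le mult.left_commute mult_nonneg_nonneg zero_le_square)
    ultimately show ?thesis unfolding inner_vec_def diag_matrix_mult_vec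
      by (auto intro!: sum_pos2)
  qed
  moreover have "transpose (diag_matrix d) = diag_matrix d"
    by (auto simp: diag_matrix_def transpose_def vec_eq_iff)
  ultimately show ?thesis by (simp add: SPD_def)
qed

text \<open>Serves to symmetrize: a product of two positive definite matrices is in general not
  symmetric, but moving one root of a factor to the other side produces a positive definite
  matrix.\<close>

lemma SPD_square_root:
  fixes A :: "real^'n^'n"
  assumes A: "A \<in> SPD"
  obtains R where "R \<in> SPD" "R ** R = A"
proof -
  obtain Q d where Q: "orthogonal_matrix Q" "A = Q ** diag_matrix d ** transpose Q" "\<And>j. d j > 0"
    using spectral_theorem_SPD[OF A] by blast
  define E where "E = (diag_matrix (\<lambda>j. sqrt (d j)) :: real^'n^'n)"
  have E: "E \<in> SPD" unfolding E_def using Q(3) by (intro diag_matrix_SPD) simp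
  have EE: "E ** E = diag_matrix d"
  proof -
    have "(E ** E) $ i $ j = diag_matrix d $ i $ j" for i j
      using Q(3)[of i] unfolding E_def mult_diag_matrix
      by (auto simp: diag_matrix_def)
    thus ?thesis by (simp add: vec_eq_iff)
  qed
  have "invertible Q" using Q(1) unfolding invertible_def orthogonal_matrix_def by blast
  show ?thesis
  proof
    show "Q ** E ** transpose Q \<in> SPD" by (rule SPD_congruence) fact+
    have "Q ** E ** transpose Q ** (Q ** E ** transpose Q)
        = Q ** E ** (transpose Q ** Q) ** E ** transpose Q"
      by (simp add: matrix_mul_assoc)
    also have "\<dots> = Q ** (E ** E) ** transpose Q"
      using Q(1) by (simp add: orthogonal_matrix_def matrix_mul_assoc)
    finally show "Q ** E ** transpose Q ** (Q ** E ** transpose Q) = A" by (simp add: EE Q(2))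
  qed
qed

text \<open>On the eigenvalues, trace minus dimension minus log-determinant is the sum of
  \<open>d j - 1 - ln (d j)\<close>. Each summand is nonnegative and vanishes only at
  \<open>d j = 1\<close>, which gives the equality case.\<close>

lemma SPD_det_trace:
  fixes A :: "real^'n^'n"
  assumes A: "A \<in> SPD"
  shows SPD_det_pos: "det A > 0"
    and SPD_ln_det_le: "ln (det A) \<le> trace A - real CARD('n)"
    and SPD_ln_det_eq: "ln (det A) = trace A - real CARD('n) \<Longrightarrow> A = mat 1"
proof -
  obtain Q d where Q: "orthogonal_matrix Q" "A = Q ** diag_matrix d ** transpose Q" "\<And>j. d j > 0"
    using spectral_theorem_SPD[OF A] by blast
  have QQ: "Q ** transpose Q = mat 1" "transpose Q ** Q = mat 1"
    using Q(1) by (auto simp: orthogonal_matrix_def)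
  have "det Q * det Q = 1" by (metis QQ(1) det_I det_mul det_transpose)
  hence "det A = prod d UNIV"
    by (simp add: Q(2) det_mul det_diag_matrix)
  moreover from this show "det A > 0" using Q(3) by (simp add: prod_pos)
  ultimately have ln: "ln (det A) = (\<Sum>j\<in>UNIV. ln (d j))"
    using Q(3) by (simp add: ln_prod less_imp_neq[symmetric])
  have "trace A = trace (transpose Q ** (Q ** diag_matrix d))"
    unfolding Q(2) by (rule trace_mul_sym)
  hence tr: "trace A = sum d UNIV" by (simp add: matrix_mul_assoc QQ trace_diag_matrix)
  have eq: "trace A - real CARD('n) - ln (det A) = (\<Sum>j\<in>UNIV. d j - 1 - ln (d j))"
    by (simp add: ln tr sum_subtractf)
  have le: "d j - 1 - ln (d j) \<ge> 0" for j using ln_le_minus_one[OF Q(3), of j] by simp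
  show "ln (det A) \<le> trace A - real CARD('n)" using eq sum_nonneg[of UNIV "\<lambda>j. d j - 1 - ln (d j)", OF le] by simp
  assume "ln (det A) = trace A - real CARD('n)"
  hence "(\<Sum>j\<in>UNIV. d j - 1 - ln (d j)) = 0" using eq by simp
  hence "d j - 1 - ln (d j) = 0" for j
    using le by (subst (asm) sum_nonneg_eq_0_iff) auto
  hence "d j = 1" for j using ln_eq_minus_one[OF Q(3), of j] by simp
  hence "diag_matrix d = mat 1" by (simp add: diag_matrix_def mat_def vec_eq_iff)
  thus "A = mat 1" by (simp add: Q(2) QQ)
qed

section \<open>Differentiating the determinant and the inverse\<close>

lemma bounded_linear_matrix_nth: "bounded_linear (\<lambda>A::real^'n^'m. A $ i $ j)"
  by (intro bounded_linear_compose[OF bounded_linear_vec_nth bounded_linear_vec_nth])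

lemma continuous_on_det [continuous_intros]:
  fixes f :: "'a::topological_space \<Rightarrow> real^'n^'n"
  assumes "continuous_on S f" shows "continuous_on S (\<lambda>x. det (f x))"
  unfolding det_def
  by (intro continuous_intros bounded_linear.continuous_on[OF bounded_linear_matrix_nth] assms)

lemma open_invertible: "open {A::real^'n^'n. invertible A}"
  unfolding invertible_det_nz by (intro open_Collect_neq continuous_intros)

text \<open>These are the cofactors that appear when the Leibniz formula is differentiated at the
  identity. A permutation fixing every index other than \<open>i\<close> also fixes
  \<open>i\<close>, so only the identity permutation survives.\<close>

lemma prod_mat_1_permutes:
  assumes p: "p permutes (UNIV::'n::finite set)"
  shows "(\<Prod>j\<in>UNIV-{i}. (mat 1 :: real^'n^'n) $ j $ p j) = (if p = id then 1 else 0)"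
proof (cases "p = id")
  case True
  thus ?thesis by (simp add: mat_def)
next
  case False
  have "\<exists>j. j \<noteq> i \<and> p j \<noteq> j"
  proof (rule ccontr)
    assume "\<not> ?thesis"
    hence fix_p: "p j = j" if "j \<noteq> i" for j using that by blast
    have "p i = i"
      by (metis fix_p p permutes_univ)
    with fix_p have "p = id" by (metis eq_id_iff)
    with False show False ..
  qed
  then obtain j where "j \<noteq> i" "p j \<noteq> j" by blast
  hence "(\<Prod>j\<in>UNIV-{i}. (mat 1 :: real^'n^'n) $ j $ p j) = 0"
    by (intro prod_zero) (auto intro!: bexI[of _ j] simp: mat_def)
  with False show ?thesis by simp
qed

lemma has_derivative_det_mat_1: "(det has_derivative trace) (at (mat 1 :: real^'n^'n))"
proof -
  let ?P = "{p. p permutes (UNIV::'n set)}"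
  have fin: "finite ?P" by (rule finite_permutations) simp
  have "(det has_derivative (\<lambda>H. \<Sum>p\<in>?P. of_int (sign p) *
      (\<Sum>i\<in>UNIV. H $ i $ p i * (\<Prod>j\<in>UNIV-{i}. (mat 1 :: real^'n^'n) $ j $ p j))))
      (at (mat 1 :: real^'n^'n))"
    unfolding det_def[abs_def]
    by (intro has_derivative_sum has_derivative_mult_right has_derivative_prod
        bounded_linear_imp_has_derivative bounded_linear_matrix_nth)
  moreover have "(\<Sum>p\<in>?P. of_int (sign p) *
      (\<Sum>i\<in>UNIV. H $ i $ p i * (\<Prod>j\<in>UNIV-{i}. (mat 1 :: real^'n^'n) $ j $ p j))) = trace H"
    for H :: "real^'n^'n"
  proof -
    have "(\<Sum>p\<in>?P. of_int (sign p) *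
      (\<Sum>i\<in>UNIV. H $ i $ p i * (\<Prod>j\<in>UNIV-{i}. (mat 1 :: real^'n^'n) $ j $ p j)))
      = (\<Sum>p\<in>?P. if p = id then trace H else 0)"
    proof (intro sum.cong refl)
      fix p assume "p \<in> ?P"
      hence "p permutes UNIV" by simp
      note pr = prod_mat_1_permutes[OF this]
      show "of_int (sign p) *
        (\<Sum>i\<in>UNIV. H $ i $ p i * (\<Prod>j\<in>UNIV-{i}. (mat 1 :: real^'n^'n) $ j $ p j))
        = (if p = id then trace H else 0)"
        unfolding pr by (simp add: trace_def sign_id)
    qed
    also have "\<dots> = trace H"
      using fin by (simp add: sum.delta permutes_id)
    finally show ?thesis .
  qed
  ultimately show ?thesis by simp
qed

text \<open>Jacobi's formula, transported from the identity matrix by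
  \<open>det X = det A * det (matrix_inv A ** X)\<close>.\<close>

theorem has_derivative_det:
  fixes A :: "real^'n^'n"
  assumes A: "invertible A"
  shows "(det has_derivative (\<lambda>H. det A * trace (matrix_inv A ** H))) (at A)"
proof -
  have "((\<lambda>X. matrix_inv A ** X) has_derivative (\<lambda>H. matrix_inv A ** H)) (at A)"
    by (intro bounded_linear_imp_has_derivative matrix_mult.bounded_linear_right)
  moreover have "(det has_derivative trace) (at (matrix_inv A ** A))"
    unfolding matrix_inv_mult[OF A] by (rule has_derivative_det_mat_1)
  ultimately have "((\<lambda>X. det (matrix_inv A ** X)) has_derivative (\<lambda>H. trace (matrix_inv A ** H))) (at A)"
    by (rule has_derivative_compose)
  hence "((\<lambda>X. det A * det (matrix_inv A ** X)) has_derivative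
    (\<lambda>H. det A * trace (matrix_inv A ** H))) (at A)"
    by (rule has_derivative_mult_right)
  moreover have "det A * det (matrix_inv A ** X) = det X" for X
    by (metis det_mul matrix_inv_cancel(1)[OF A])
  ultimately show ?thesis by simp
qed

text \<open>Cramer's rule expresses each entry of the inverse as a quotient of determinants, which
  are continuous.\<close>

lemma continuous_on_matrix_inv:
  "continuous_on {A::real^'n^'n. invertible A} matrix_inv"
proof -
  have eq: "matrix_inv A = (\<chi> k l. det (\<chi> i j. if j = k then axis l 1 $ i else A $ i $ j) / det A)"
    if "invertible A" for A :: "real^'n^'n"
  proof -
    have "matrix_inv A $ k $ l = det (\<chi> i j. if j = k then axis l 1 $ i else A $ i $ j) / det A" for k l
    proof -
      have "A *v (matrix_inv A *v axis l 1) = axis l 1"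
        by (simp add: matrix_vector_mul_assoc matrix_inv_mult[OF that])
      hence "matrix_inv A *v axis l 1
          = (\<chi> k. det (\<chi> i j. if j = k then axis l 1 $ i else A $ i $ j) / det A)"
        using that by (subst (asm) cramer) (simp_all add: invertible_det_nz)
      thus ?thesis by (simp add: matrix_vector_mult_basis column_def vec_eq_iff)
    qed
    thus ?thesis by (simp add: vec_eq_iff)
  qed
  have "continuous_on {A::real^'n^'n. invertible A}
    (\<lambda>A. \<chi> k l. det (\<chi> i j. if j = k then axis l 1 $ i else A $ i $ j) / det A)"
  proof (intro continuous_intros)
    fix k l i j :: 'n
    show "continuous_on {A::real^'n^'n. invertible A} (\<lambda>A. if j = k then axis l 1 $ i else A $ i $ j)"
      by (cases "j = k") (auto intro!: continuous_intros)
  qed (auto simp: invertible_det_nz)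
  thus ?thesis by (rule continuous_on_cong[THEN iffD1, rotated -1]) (simp_all add: eq)
qed

lemma isCont_matrix_inv:
  fixes A :: "real^'n^'n" assumes "invertible A" shows "isCont matrix_inv A"
  using continuous_on_matrix_inv open_invertible assms
  by (metis continuous_on_eq_continuous_at mem_Collect_eq)

text \<open>The resolvent identity. It gives the derivative of the inverse from mere continuity, and
  later a Lipschitz bound from mere boundedness of the inverse.\<close>

lemma matrix_inv_diff:
  fixes A B :: "real^'n^'n" assumes "invertible A" "invertible B"
  shows "matrix_inv A - matrix_inv B = matrix_inv A ** (B - A) ** matrix_inv B"
  using matrix_inv_mult[OF assms(1)] matrix_inv_mult[OF assms(2)]
  by (simp add: matrix_mult.diff_left matrix_mult.diff_right flip: matrix_mul_assoc)

text \<open>Caratheodory's criterion: a difference quotient that extends continuously to 0 has its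
  value there as derivative.\<close>

lemma has_vector_derivative_at_0I:
  fixes f h :: "real \<Rightarrow> 'a::real_normed_vector"
  assumes h: "isCont h 0" and f: "\<forall>\<^sub>F s in at 0. f s = f 0 + s *\<^sub>R h s"
  shows "(f has_vector_derivative h 0) (at 0)"
proof -
  have "((\<lambda>s. norm (h s - h 0)) \<longlongrightarrow> norm (h 0 - h 0)) (at 0)"
    using h by (intro tendsto_intros) (simp add: isCont_def)
  hence lim: "((\<lambda>s. norm (h s - h 0)) \<longlongrightarrow> 0) (at 0)" by simp
  have "\<forall>\<^sub>F s in at 0. s \<noteq> (0::real)" by (simp add: eventually_at_filter)
  hence ev: "\<forall>\<^sub>F s in at 0. norm (h s - h 0) = norm (f s - f 0 - s *\<^sub>R h 0) / norm s"
    using f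
  proof eventually_elim
    case (elim s)
    have "f s - f 0 - s *\<^sub>R h 0 = s *\<^sub>R (h s - h 0)"
      using elim(2) by (simp add: algebra_simps)
    thus ?case using elim(1) by simp
  qed
  have "((\<lambda>s. norm (f s - f 0 - s *\<^sub>R h 0) / norm s) \<longlongrightarrow> 0) (at 0)"
    using lim ev by (rule Lim_transform_eventually)
  thus ?thesis
    by (simp add: has_vector_derivative_def has_derivative_at bounded_linear_scaleR_left)
qed

lemma eventually_invertible_line:
  fixes P :: "real^'n^'n" assumes P: "invertible P"
  shows "\<forall>\<^sub>F s::real in nhds 0. invertible (P + s *\<^sub>R X)"
proof -
  have "((\<lambda>s::real. P + s *\<^sub>R X) \<longlongrightarrow> P + 0 *\<^sub>R X) (nhds 0)"
    by (intro tendsto_intros tendsto_ident_at filterlim_ident)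
  hence "\<forall>\<^sub>F s in nhds (0::real). P + s *\<^sub>R X \<in> {A. invertible A}"
    using P by (intro topological_tendstoD[OF _ open_invertible]) auto
  thus ?thesis by simp
qed

lemma has_vector_derivative_matrix_inv_line:
  fixes P :: "real^'n^'n"
  assumes P: "invertible P"
  shows "((\<lambda>s. matrix_inv (P + s *\<^sub>R X)) has_vector_derivative
    - (matrix_inv P ** X ** matrix_inv P)) (at 0)"
proof -
  define h where "h = (\<lambda>s. - (matrix_inv (P + s *\<^sub>R X) ** X ** matrix_inv P))"
  have "isCont (\<lambda>s. matrix_inv (P + s *\<^sub>R X)) 0"
  proof (rule isCont_o2[of _ _ matrix_inv])
    show "isCont (\<lambda>s. P + s *\<^sub>R X) 0" by (intro continuous_intros)
  qed (use isCont_matrix_inv[OF P] in simp)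
  hence h: "isCont h 0"
    unfolding h_def by (intro continuous_intros matrix_mult.isCont)
  have "\<forall>\<^sub>F s in at 0. invertible (P + s *\<^sub>R X)"
    using eventually_invertible_line[OF P] by (simp add: eventually_nhds_conv_at)
  hence "\<forall>\<^sub>F s in at 0. matrix_inv (P + s *\<^sub>R X) = matrix_inv (P + 0 *\<^sub>R X) + s *\<^sub>R h s"
  proof eventually_elim
    case (elim s)
    have "matrix_inv (P + s *\<^sub>R X) - matrix_inv P
      = matrix_inv (P + s *\<^sub>R X) ** (- (s *\<^sub>R X)) ** matrix_inv P"
      using matrix_inv_diff[OF elim P] by simp
    also have "\<dots> = s *\<^sub>R h s"
      by (simp add: h_def matrix_mult.minus_right matrix_mult.minus_left
          matrix_mult.scaleR_right matrix_mult.scaleR_left)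
    finally show ?case by (simp add: algebra_simps)
  qed
  from has_vector_derivative_at_0I[OF h this] show ?thesis by (simp add: h_def)
qed

section \<open>The gradient and the Hessian on the cone\<close>

text \<open>The Frobenius complement of the symmetric matrices consists of the skew ones. For the
  forward direction, testing against the symmetric matrix \<open>M + transpose M\<close> makes its
  norm vanish.\<close>

lemma inner_Sym_eq_0_iff:
  fixes M :: "real^'n^'n"
  shows "(\<forall>H\<in>Sym. M \<bullet> H = 0) \<longleftrightarrow> M + transpose M = 0"
proof
  assume L: "\<forall>H\<in>Sym. M \<bullet> H = 0"
  have "M + transpose M \<in> Sym" by (simp add: Sym_def transpose_add add.commute)
  hence 0: "M \<bullet> (M + transpose M) = 0" using L by blast
  have "transpose M \<bullet> transpose (M + transpose M) = 0"
    using 0 by (simp only: inner_matrix_transpose)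
  hence "transpose M \<bullet> (M + transpose M) = 0" by (simp add: transpose_add add.commute)
  with 0 have "(M + transpose M) \<bullet> (M + transpose M) = 0" by (simp only: inner_add_left)
  thus "M + transpose M = 0" by simp
next
  assume R: "M + transpose M = 0"
  show "\<forall>H\<in>Sym. M \<bullet> H = 0"
  proof
    fix H :: "real^'n^'n" assume H: "H \<in> Sym"
    have "transpose M \<bullet> H = M \<bullet> H"
      using inner_matrix_transpose[of M H] transpose_Sym[OF H] by simp
    moreover have "(M + transpose M) \<bullet> H = 0" using R by simp
    ultimately show "M \<bullet> H = 0" by (simp add: inner_add_left)
  qed
qed

text \<open>With a root \<open>R\<close> of \<open>A\<close> moved across the pairing, the form
  becomes that of \<open>B\<close> at \<open>R ** X\<close>, and \<open>R ** X\<close> is nonzero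
  because \<open>R\<close> is invertible.\<close>

lemma SPD_mult_both_inner_pos:
  fixes A B X :: "real^'n^'n"
  assumes A: "A \<in> SPD" and B: "B \<in> SPD" and X: "X \<noteq> 0"
  shows "(A ** X ** B) \<bullet> X > 0"
proof -
  obtain R where R: "R \<in> SPD" "R ** R = A" by (rule SPD_square_root[OF A])
  have "R ** X \<noteq> 0"
  proof
    assume "R ** X = 0"
    hence "matrix_inv R ** (R ** X) = 0" by (simp add: matrix_mult.zero_right)
    with X show False by (simp add: matrix_inv_cancel[OF SPD_invertible[OF R(1)]])
  qed
  hence "0 < (R ** X ** B) \<bullet> (R ** X)" by (rule inner_mult_SPD_pos[OF B])
  also have "\<dots> = (transpose R ** (R ** X ** B)) \<bullet> X"
    by (simp add: inner_matrix_mult_left)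
  also have "\<dots> = (A ** X ** B) \<bullet> X"
    by (simp add: transpose_SPD[OF R(1)] matrix_mul_assoc R(2))
  finally show ?thesis .
qed

lemma Sym_matrix_inv:
  assumes "A \<in> Sym" "invertible A" shows "matrix_inv A \<in> Sym"
  using transpose_matrix_inv[OF assms(2)] transpose_Sym[OF assms(1)] by (simp add: Sym_def)

locale spd_pair =
  fixes S0 S1 :: "real^'n^'n"
  assumes S0: "S0 \<in> SPD" and S1: "S1 \<in> SPD"
begin

abbreviation "F \<equiv> lift_entropy S0 S1"
abbreviation "gmet \<equiv> lift_metric S0"
abbreviation "proj \<equiv> tangent_proj S0"
abbreviation "I0 \<equiv> matrix_inv S0"
abbreviation "I1 \<equiv> matrix_inv S1"

text \<open>One operator for two purposes: its inverse yields both the tangential projection and the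
  correction \<open>V\<close> of the flow.\<close>

definition syl :: "real^'n^'n \<Rightarrow> real^'n^'n" where "syl V = S0 ** V + V ** S0"

text \<open>The ambient gradient of \<open>F\<close> with respect to the metric; the factor
  \<open>I0\<close> compensates the \<open>S0\<close> in the metric. The transpose is there because
  \<open>A\<close> ranges over all invertible matrices, not only the cone.\<close>

definition grad :: "real^'n^'n \<Rightarrow> real^'n^'n" where
  "grad A = transpose (matrix_inv A) ** I0 - I1 ** A"

lemma I0: "I0 \<in> SPD" and I1: "I1 \<in> SPD"
  using S0 S1 by (simp_all add: SPD_matrix_inv)

lemma transposes: "transpose S0 = S0" "transpose S1 = S1" "transpose I0 = I0" "transpose I1 = I1"
  using S0 S1 I0 I1 by (simp_all add: transpose_SPD)

lemma inv_mults: "S0 ** I0 = mat 1" "I0 ** S0 = mat 1" "S1 ** I1 = mat 1" "I1 ** S1 = mat 1"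
  using S0 S1 by (simp_all add: matrix_inv_mult SPD_invertible)

lemma metric_inner: "gmet X Y = (X ** S0) \<bullet> Y"
  by (simp add: lift_metric_def trace_matrix_mult_inner matrix_transpose_mul transposes)

lemma metric_commute: "gmet X Y = gmet Y X"
  unfolding metric_inner by (metis inner_commute inner_matrix_mult_right transposes(1))

sublocale gmet: bounded_bilinear "lift_metric S0"
proof -
  interpret bl: bounded_linear "\<lambda>X. X ** S0"
    by (rule matrix_mult.bounded_linear_left)
  show "bounded_bilinear gmet"
    unfolding metric_inner[abs_def]
    by (rule bounded_bilinear.comp1[OF bounded_bilinear_inner bl.bounded_linear_axioms])
qed

lemma metric_pos: "X \<noteq> 0 \<Longrightarrow> gmet X X > 0"
  unfolding metric_inner by (rule inner_mult_SPD_pos[OF S0])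

lemma metric_nonneg: "gmet X X \<ge> 0"
  using metric_pos[of X] by (cases "X = 0") (auto simp: gmet.zero_left)

lemma metric_coercive: obtains \<mu> where "\<mu> > 0" "\<And>X. gmet X X \<ge> \<mu> * (norm X)\<^sup>2"
  using positive_form_coercive[OF bounded_linear.linear[OF matrix_mult.bounded_linear_left]
      inner_mult_SPD_pos[OF S0]] that
  unfolding metric_inner by blast

lemma linear_syl: "linear syl"
  unfolding syl_def
  by (intro linear_compose_add bounded_linear.linear matrix_mult.bounded_linear_left
      matrix_mult.bounded_linear_right)

text \<open>Both summands of \<open>syl V \<bullet> V\<close> are positive for nonzero
  \<open>V\<close>; the left multiplication is turned into a right one by transposing.\<close>

lemma inj_syl: "inj syl"
proof -
  have "V = 0" if "syl V = 0" for V
  proof (rule ccontr)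
    assume V: "V \<noteq> 0"
    hence "transpose V \<noteq> 0" by (metis transpose_transpose transpose_0)
    hence "(transpose V ** S0) \<bullet> transpose V > 0" by (rule inner_mult_SPD_pos[OF S0])
    also have "transpose V ** S0 = transpose (S0 ** V)"
      by (simp add: matrix_transpose_mul transposes)
    finally have "(S0 ** V) \<bullet> V > 0" by (simp only: inner_matrix_transpose)
    moreover have "(V ** S0) \<bullet> V > 0" by (rule inner_mult_SPD_pos[OF S0 V])
    ultimately have "syl V \<bullet> V > 0" by (simp add: syl_def inner_add_left)
    with that show False by simp
  qed
  thus ?thesis using linear_injective_0[OF linear_syl] by blast
qed

lemma bij_syl: "bij syl"
  using inj_syl linear_injective_imp_surjective[OF linear_syl inj_syl] by (simp add: bij_def)

lemma syl_eq_iff: "syl V = M \<longleftrightarrow> V = inv syl M"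
  using bij_syl by (metis bij_inv_eq_iff)

lemma transpose_syl: "transpose (syl V) = syl (transpose V)"
  by (simp add: syl_def transpose_add matrix_transpose_mul transposes add.commute)

text \<open>Orthogonality to \<open>Sym\<close> means that \<open>(X - Y) ** S0\<close> is skew,
  which for symmetric \<open>Y\<close> is the Sylvester equation. Conversely its right-hand side is
  symmetric, so \<open>transpose Y\<close> solves it too, and injectivity of \<open>syl\<close>
  forces \<open>Y\<close> to be symmetric.\<close>

lemma tangent_proj_char:
  "Y \<in> Sym \<and> (\<forall>H\<in>Sym. gmet (X - Y) H = 0) \<longleftrightarrow> syl Y = X ** S0 + S0 ** transpose X"
proof -
  have *: "(\<forall>H\<in>Sym. gmet (X - Y) H = 0) \<longleftrightarrow> syl Y = X ** S0 + S0 ** transpose X"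
    if Y: "Y \<in> Sym"
  proof -
    have "(X - Y) ** S0 + transpose ((X - Y) ** S0) = X ** S0 + S0 ** transpose X - syl Y"
      using transpose_Sym[OF Y]
      by (simp add: matrix_transpose_mul transposes transpose_diff matrix_mult.diff_left
          matrix_mult.diff_right syl_def)
    thus ?thesis unfolding metric_inner inner_Sym_eq_0_iff by auto
  qed
  moreover have "Y \<in> Sym" if Y: "syl Y = X ** S0 + S0 ** transpose X"
  proof -
    have "syl (transpose Y) = transpose (syl Y)" by (simp add: transpose_syl)
    also have "\<dots> = syl Y"
      by (simp add: Y transpose_add matrix_transpose_mul transposes add.commute)
    finally have "transpose Y = Y" using inj_syl by (simp add: inj_eq)
    thus ?thesis by (simp add: Sym_def)
  qed
  ultimately show ?thesis by blast
qed

lemma tangent_proj_eq: "proj X = inv syl (X ** S0 + S0 ** transpose X)"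
  unfolding tangent_proj_def tangent_proj_char syl_eq_iff by simp

lemma tangent_proj_eqI: "syl Y = X ** S0 + S0 ** transpose X \<Longrightarrow> proj X = Y"
  unfolding tangent_proj_eq syl_eq_iff by simp

lemma tangent_proj_Sym: "proj X \<in> Sym"
  and metric_proj: "H \<in> Sym \<Longrightarrow> gmet (proj X) H = gmet X H"
proof -
  have "syl (proj X) = X ** S0 + S0 ** transpose X"
    by (simp add: syl_eq_iff tangent_proj_eq)
  from this[folded tangent_proj_char] show "proj X \<in> Sym"
    and "H \<in> Sym \<Longrightarrow> gmet (proj X) H = gmet X H"
    by (auto simp: gmet.diff_left)
qed

lemma bounded_linear_proj: "bounded_linear proj"
proof -
  have "linear (inv syl)" using linear_syl bij_syl
    by (metis linear_injective_left_inverse inj_syl bij_betw_def left_right_inverse_eq surj_iff)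
  moreover have "bounded_linear (\<lambda>X. X ** S0 + S0 ** transpose X)"
    by (intro bounded_linear_add matrix_mult.bounded_linear_left
        bounded_linear_compose[OF matrix_mult.bounded_linear_right bounded_linear_transpose])
  ultimately show ?thesis
    unfolding tangent_proj_eq[abs_def] linear_conv_bounded_linear
    using bounded_linear_compose by blast
qed

text \<open>The determinant enters as the product \<open>det A * det A\<close> under the logarithm,
  since \<open>det A\<close> may be negative off the cone and \<open>F\<close> is differentiated at
  every invertible matrix.\<close>

lemma lift_entropy_eq:
  "F A = real CARD('n) / 2 - 1/2 * ((I1 ** A ** S0) \<bullet> A)
    + 1/2 * ln (det I1 * det S0 * (det A * det A))"
  unfolding lift_entropy_def
  by (simp add: trace_mul_sym[of _ "transpose A"] trace_matrix_mult_inner inner_matrix_transpose det_mul mult_ac inner_commute)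

lemma det_const_pos: "det I1 * det S0 > 0"
  using SPD_det_pos[OF I1] SPD_det_pos[OF S0] by simp

lemma grad_mult_S0: "grad A ** S0 = transpose (matrix_inv A) - I1 ** A ** S0"
  by (simp add: grad_def matrix_mult.diff_left inv_mults flip: matrix_mul_assoc)

lemma has_derivative_lift_entropy:
  assumes A: "invertible A"
  shows "(F has_derivative gmet (grad A)) (at A)"
proof -
  define c where "c = det I1 * det S0"
  have c: "c > 0" using det_const_pos by (simp add: c_def)
  have detA: "det A \<noteq> 0" using A by (simp add: invertible_det_nz)
  define D where "D = (\<lambda>H. det A * trace (matrix_inv A ** H))"
  have d: "(det has_derivative D) (at A)" unfolding D_def by (rule has_derivative_det[OF A])
  have bl: "bounded_linear (\<lambda>X. I1 ** X ** S0)"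
    by (intro bounded_linear_compose[OF matrix_mult.bounded_linear_left matrix_mult.bounded_linear_right])
  have 1: "((\<lambda>X. (I1 ** X ** S0) \<bullet> X) has_derivative
      (\<lambda>H. (I1 ** A ** S0) \<bullet> H + (I1 ** H ** S0) \<bullet> A)) (at A)"
    by (intro has_derivative_inner bounded_linear_imp_has_derivative[OF bl] has_derivative_ident)
  have 2: "((\<lambda>X. c * (det X * det X)) has_derivative (\<lambda>H. c * (det A * D H + D H * det A))) (at A)"
    by (intro has_derivative_mult_right has_derivative_mult d)
  have 3: "((\<lambda>X. ln (c * (det X * det X))) has_derivative
      (\<lambda>H. inverse (c * (det A * det A)) * (c * (det A * D H + D H * det A)))) (at A)"
  proof (rule has_derivative_compose[OF 2])
    have "c * (det A * det A) > 0" using c detA by (auto simp: zero_less_mult_iff)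
    from DERIV_ln[OF this] show "(ln has_derivative (*) (inverse (c * (det A * det A))))
        (at (c * (det A * det A)))"
      by (simp add: has_field_derivative_def)
  qed
  have "(F has_derivative (\<lambda>H. - 1/2 * ((I1 ** A ** S0) \<bullet> H + (I1 ** H ** S0) \<bullet> A)
      + 1/2 * (inverse (c * (det A * det A)) * (c * (det A * D H + D H * det A))))) (at A)"
    unfolding lift_entropy_eq[abs_def] c_def[symmetric]
    by (rule derivative_eq_intros 1 3 refl)+ (simp add: fun_eq_iff)
  moreover have "- 1/2 * ((I1 ** A ** S0) \<bullet> H + (I1 ** H ** S0) \<bullet> A)
      + 1/2 * (inverse (c * (det A * det A)) * (c * (det A * D H + D H * det A))) = gmet (grad A) H"
    for H
  proof -
    \<comment> \<open>\<open>I1\<close> and \<open>S0\<close> are symmetric, so the quadratic term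
      comes from a symmetric bilinear form and its two derivative terms coincide.\<close>
    have "(I1 ** H ** S0) \<bullet> A = H \<bullet> (I1 ** A ** S0)"
      by (simp add: inner_matrix_mult_right[of "I1 ** H"] inner_matrix_mult_left[of I1]
          transposes matrix_mul_assoc)
    moreover have "inverse (c * (det A * det A)) * (c * (det A * D H + D H * det A))
        = 2 * trace (matrix_inv A ** H)"
      using c detA by (simp add: D_def field_simps)
    ultimately show ?thesis
      unfolding metric_inner grad_mult_S0
      by (simp add: inner_diff_left trace_matrix_mult_inner inner_commute[of H])
  qed
  ultimately show ?thesis by simp
qed

lemma lift_grad_eq: assumes A: "invertible A" shows "lift_grad S0 F A = grad A"
  unfolding lift_grad_def
proof (rule the_equality)
  show "(F has_derivative gmet (grad A)) (at A)" by (rule has_derivative_lift_entropy[OF A])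
  fix X assume "(F has_derivative gmet X) (at A)"
  hence "gmet X = gmet (grad A)"
    using has_derivative_lift_entropy[OF A] by (rule has_derivative_unique)
  hence "gmet (X - grad A) (X - grad A) = 0" by (simp add: gmet.diff_left)
  thus "X = grad A" using metric_pos[of "X - grad A"] by fastforce
qed

section \<open>The flow field as a projected gradient, and the Hessian\<close>

lemma cone_grad_eq: "invertible P \<Longrightarrow> cone_grad S0 F P = proj (grad P)"
  by (simp add: cone_grad_def lift_grad_eq)

lemma sylvester_iff:
  assumes P: "P \<in> SPD"
  shows "sylvester S0 S1 P V \<longleftrightarrow> syl V = S0 ** (transpose (grad P) - grad P)"
proof -
  have "transpose (grad P) - grad P
    = I0 ** matrix_inv P - matrix_inv P ** I0 + I1 ** P - P ** I1"
    using transpose_SPD[OF P] transpose_SPD[OF SPD_matrix_inv[OF P]]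
    by (simp add: grad_def transpose_diff matrix_transpose_mul transposes)
  thus ?thesis by (simp add: sylvester_def syl_def)
qed

lemma sylvester_unique: "P \<in> SPD \<Longrightarrow> \<exists>!V. sylvester S0 S1 P V"
  unfolding sylvester_iff syl_eq_iff by simp

text \<open>Applying \<open>syl\<close> to \<open>grad P + V\<close> cancels
  \<open>S0 ** grad P\<close> and leaves exactly the right-hand side that characterizes the
  projection of \<open>grad P\<close>.\<close>

lemma flow_field_eq:
  assumes P: "P \<in> SPD" shows "flow_field S0 S1 P = proj (grad P)"
proof -
  define V where "V = (THE V. sylvester S0 S1 P V)"
  have "sylvester S0 S1 P V" unfolding V_def by (rule theI'[OF sylvester_unique[OF P]])
  hence V: "syl V = S0 ** (transpose (grad P) - grad P)" by (simp add: sylvester_iff[OF P])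
  have "syl (grad P + V) = grad P ** S0 + S0 ** transpose (grad P)"
    unfolding linear_add[OF linear_syl] V
    by (simp add: syl_def matrix_mult.diff_right)
  hence "proj (grad P) = grad P + V" by (rule tangent_proj_eqI)
  moreover have "grad P = matrix_inv P ** I0 - I1 ** P"
    by (simp add: grad_def transpose_SPD[OF SPD_matrix_inv[OF P]])
  ultimately show ?thesis by (simp add: flow_field_def V_def)
qed

lemma cone_grad_eq_flow_field: "P \<in> SPD \<Longrightarrow> cone_grad S0 F P = flow_field S0 S1 P"
  by (simp add: cone_grad_eq flow_field_eq SPD_invertible)

definition grad_deriv :: "real^'n^'n \<Rightarrow> real^'n^'n \<Rightarrow> real^'n^'n" where
  "grad_deriv P X = - (matrix_inv P ** X ** matrix_inv P) ** I0 - I1 ** X"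

lemma has_vector_derivative_cone_grad_line:
  assumes P: "P \<in> SPD" and X: "X \<in> Sym"
  shows "((\<lambda>s. cone_grad S0 F (P + s *\<^sub>R X)) has_vector_derivative proj (grad_deriv P X)) (at 0)"
proof -
  have "((\<lambda>s. proj (matrix_inv (P + s *\<^sub>R X) ** I0 - I1 ** (P + s *\<^sub>R X)))
      has_vector_derivative proj (grad_deriv P X)) (at 0)"
  proof (rule bounded_linear.has_vector_derivative[OF bounded_linear_proj])
    have "((\<lambda>s. matrix_inv (P + s *\<^sub>R X) ** I0) has_vector_derivative
        - (matrix_inv P ** X ** matrix_inv P) ** I0) (at 0)"
      by (rule bounded_linear.has_vector_derivative[OF matrix_mult.bounded_linear_left
            has_vector_derivative_matrix_inv_line[OF SPD_invertible[OF P]]])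
    moreover have "((\<lambda>s. I1 ** (P + s *\<^sub>R X)) has_vector_derivative I1 ** X) (at 0)"
      by (rule bounded_linear.has_vector_derivative[OF matrix_mult.bounded_linear_right])
         (auto intro!: derivative_eq_intros)
    ultimately show "((\<lambda>s. matrix_inv (P + s *\<^sub>R X) ** I0 - I1 ** (P + s *\<^sub>R X))
        has_vector_derivative grad_deriv P X) (at 0)"
      unfolding grad_deriv_def by (rule has_vector_derivative_diff)
  qed
  \<comment> \<open>The explicit formula for \<open>cone_grad\<close> is available only where the
    line stays invertible; agreement near \<open>s = 0\<close> suffices for the derivative.\<close>
  moreover have "\<forall>\<^sub>F s in nhds 0. cone_grad S0 F (P + s *\<^sub>R X)
      = proj (matrix_inv (P + s *\<^sub>R X) ** I0 - I1 ** (P + s *\<^sub>R X))"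
    using eventually_invertible_line[OF SPD_invertible[OF P], of X]
  proof eventually_elim
    case (elim s)
    have "P + s *\<^sub>R X \<in> Sym"
      by (intro subspace_add subspace_scale subspace_Sym SPD_imp_Sym[OF P] X)
    hence "transpose (matrix_inv (P + s *\<^sub>R X)) = matrix_inv (P + s *\<^sub>R X)"
      using Sym_matrix_inv[OF _ elim] transpose_Sym by blast
    thus ?case by (simp add: cone_grad_eq[OF elim] grad_def)
  qed
  ultimately show ?thesis
    by (subst has_vector_derivative_cong_ev) (auto elim: eventually_mono dest: eventually_nhds_x_imp_x)
qed

text \<open>\<open>cone_grad\<close> is already tangential, so the outer projection of the covariant
  derivative changes nothing when paired with symmetric \<open>X\<close>. Pairing with
  \<open>X\<close> also removes the inner projection, after which the \<open>S0\<close> of the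
  metric cancels \<open>I0\<close>.\<close>

lemma cone_hess_eq:
  assumes P: "P \<in> SPD" and X: "X \<in> Sym"
  shows cone_hess_eq_metric: "cone_hess S0 F P X X = gmet (proj (grad_deriv P X)) X"
    and cone_hess_eq_inner: "- cone_hess S0 F P X X
      = (matrix_inv P ** X ** matrix_inv P) \<bullet> X + (I1 ** X ** S0) \<bullet> X"
proof -
  have "cone_hess S0 F P X X = gmet (proj (proj (grad_deriv P X))) X"
    unfolding cone_hess_def cone_cov_deriv_def
    by (subst vector_derivative_at[OF has_vector_derivative_cone_grad_line[OF P X]]) (rule refl)
  thus 1: "cone_hess S0 F P X X = gmet (proj (grad_deriv P X)) X"
    by (simp add: metric_proj X)
  have "gmet (proj (grad_deriv P X)) X = (grad_deriv P X ** S0) \<bullet> X"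
    using metric_proj[OF X] by (simp add: metric_inner)
  also have "grad_deriv P X ** S0 = - (matrix_inv P ** X ** matrix_inv P) - I1 ** X ** S0"
    by (simp add: grad_deriv_def matrix_mult.diff_left matrix_mult.minus_left inv_mults
        flip: matrix_mul_assoc)
  finally show "- cone_hess S0 F P X X
      = (matrix_inv P ** X ** matrix_inv P) \<bullet> X + (I1 ** X ** S0) \<bullet> X"
    by (simp add: 1 inner_diff_left)
qed

text \<open>The summand depending on \<open>P\<close> is nonnegative and is dropped. The remaining
  form is at least \<open>\<mu>\<close> times the squared norm, while the metric is at most
  \<open>K\<close> times it, whence the constant \<open>\<mu> / K\<close>.\<close>

lemma hess_bound_exists: "\<exists>\<alpha>>0. hess_bound S0 S1 \<alpha>"
proof -
  have "linear (\<lambda>X. I1 ** X ** S0)"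
    by (intro bounded_linear.linear
        bounded_linear_compose[OF matrix_mult.bounded_linear_left matrix_mult.bounded_linear_right])
  from positive_form_coercive[OF this SPD_mult_both_inner_pos[OF I1 S0]]
  obtain \<mu> where \<mu>: "\<mu> > 0" "\<And>X. (I1 ** X ** S0) \<bullet> X \<ge> \<mu> * (norm X)\<^sup>2" by blast
  obtain K where K: "K > 0" "\<And>X Y. norm (gmet X Y) \<le> norm X * norm Y * K"
    using gmet.pos_bounded by blast
  have "hess_bound S0 S1 (\<mu> / K)" unfolding hess_bound_def
  proof (intro ballI)
    fix P X :: "real^'n^'n" assume P: "P \<in> SPD" and X: "X \<in> Sym"
    have "\<mu> / K * gmet X X \<le> \<mu> / K * (norm X * norm X * K)"
      using K(1) \<mu>(1) K(2)[of X X] by (intro mult_left_mono) auto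
    also have "\<dots> = \<mu> * (norm X)\<^sup>2" using K(1) by (simp add: power2_eq_square)
    also have "\<dots> \<le> (I1 ** X ** S0) \<bullet> X" by (rule \<mu>(2))
    also have "\<dots> \<le> (matrix_inv P ** X ** matrix_inv P) \<bullet> X + (I1 ** X ** S0) \<bullet> X"
      using SPD_mult_both_inner_pos[OF SPD_matrix_inv[OF P] SPD_matrix_inv[OF P], of X]
      by (cases "X = 0") auto
    finally show "\<mu> / K * gmet X X \<le> - cone_hess S0 F P X X"
      by (simp add: cone_hess_eq_inner[OF P X])
  qed
  thus ?thesis using \<mu>(1) K(1) by (intro exI[of _ "\<mu> / K"]) simp
qed

end

section \<open>A global Picard theorem\<close>

lemma integral_exp_scaled:
  assumes "k > 0" "t \<ge> (0::real)"
  shows "(\<lambda>s. exp (k * s)) integrable_on {0..t}"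
    and "integral {0..t} (\<lambda>s. exp (k * s)) \<le> exp (k * t) / k"
proof -
  have "((\<lambda>s. exp (k * s)) has_integral exp (k * t) / k - exp (k * 0) / k) {0..t}"
    using assms
    by (intro fundamental_theorem_of_calculus)
       (auto intro!: derivative_eq_intros simp flip: has_real_derivative_iff_has_vector_derivative)
  thus "(\<lambda>s. exp (k * s)) integrable_on {0..t}"
    and "integral {0..t} (\<lambda>s. exp (k * s)) \<le> exp (k * t) / k"
    using assms(1) by (auto simp: integrable_on_def integral_unique)
qed

lemma integral_has_vector_derivative_atLeast:
  fixes g :: "real \<Rightarrow> 'a::banach"
  assumes g: "continuous_on UNIV g" and t: "t \<ge> 0"
  shows "((\<lambda>t. integral {0..t} g) has_vector_derivative g t) (at t within {0..})"
proof -
  have "((\<lambda>t. integral {0..t} g) has_vector_derivative g t) (at t within {0..t+1})"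
    using t by (intro integral_has_vector_derivative continuous_on_subset[OF g]) auto
  \<comment> \<open>The extra unit keeps \<open>t\<close> away from the right endpoint, so both
    filters agree near \<open>t\<close>, including the one-sided case \<open>t = 0\<close>.\<close>
  moreover have "at t within {0..t+1} = at t within {0..}"
    using t by (intro at_within_nhd[of _ "{t-1<..<t+1}"]) auto
  ultimately show ?thesis by simp
qed

text \<open>Integrating \<open>exp (k * s)\<close> gains a factor \<open>1 / k\<close>, and the
  weight cancels the growth. This gives boundedness of the Picard operator and, with
  \<open>M\<close> proportional to \<open>L\<close>, its contraction factor
  \<open>L / k\<close>.\<close>

lemma norm_weighted_integral_le:
  fixes g :: "real \<Rightarrow> 'a::banach"
  assumes g: "continuous_on UNIV g" and k: "k > 0" and t: "t \<ge> 0"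
    and bound: "\<And>s. s \<ge> 0 \<Longrightarrow> norm (g s) \<le> M * exp (k * s)"
  shows "norm (exp (- k * t) *\<^sub>R integral {0..t} g) \<le> M / k"
proof -
  have M: "M \<ge> 0" using order_trans[OF norm_ge_zero bound[of 0]] by simp
  note int = integral_exp_scaled[OF k t]
  have "norm (integral {0..t} g) \<le> integral {0..t} (\<lambda>s. M * exp (k * s))"
    using bound int(1)
    by (intro integral_norm_bound_integral integrable_continuous_real continuous_on_subset[OF g])
       (auto intro!: continuous_intros)
  also have "\<dots> = M * integral {0..t} (\<lambda>s. exp (k * s))" by simp
  also have "\<dots> \<le> M * (exp (k * t) / k)" by (intro mult_left_mono int M)
  finally have "exp (- k * t) * norm (integral {0..t} g) \<le> exp (- k * t) * (M * (exp (k * t) / k))"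
    by (intro mult_left_mono) auto
  also have "\<dots> = M / k" by (simp add: exp_minus)
  finally show ?thesis by simp
qed

text \<open>Banach's theorem for the Picard operator in the weighted norm
  \<open>sup\<^sub>t exp (-kt) |x t - x0|\<close> with \<open>k > L\<close>; the weight makes it a contraction on the whole half-line.\<close>

theorem global_lipschitz_ode_solution:
  fixes f :: "'a::euclidean_space \<Rightarrow> 'a"
  assumes f: "L-lipschitz_on UNIV f"
  obtains x where "x 0 = x0"
    "\<And>t. t \<ge> 0 \<Longrightarrow> (x has_vector_derivative f (x t)) (at t within {0..})"
proof -
  have L: "L \<ge> 0" using f by (rule lipschitz_on_nonneg)
  \<comment> \<open>This choice gives \<open>L / k < 1\<close> and remains positive when
    \<open>L = 0\<close>.\<close>
  define k where "k = L + 1"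
  have k: "k > 0" "L < k" using L by (auto simp: k_def)
  \<comment> \<open>The unknown \<open>u\<close> is the weighted deviation: the trajectory is
    \<open>x0 + exp (k * s) *\<^sub>R u s\<close>, and \<open>E u\<close> is the field along
    it.\<close>
  define E where "E = (\<lambda>(u :: real \<Rightarrow>\<^sub>C 'a) s. f (x0 + exp (k * s) *\<^sub>R u s))"
  \<comment> \<open>Bounded continuous functions live on the whole line; \<open>max 0 t\<close>
    extends the operator to negative times by 0.\<close>
  define T where "T = (\<lambda>u t. exp (- k * max 0 t) *\<^sub>R integral {0..max 0 t} (E u))"
  have contE: "continuous_on UNIV (E u)" for u
    unfolding E_def
    by (intro continuous_on_compose2[OF lipschitz_on_continuous_on[OF f]] continuous_intros) auto
  have E_diff: "norm (E u s - E v s) \<le> L * norm (u - v) * exp (k * s)" for u v s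
  proof -
    have "norm (E u s - E v s) \<le> L * norm (exp (k * s) *\<^sub>R (u - v) s)"
      unfolding E_def using lipschitz_on_normD[OF f, of "x0 + exp (k * s) *\<^sub>R u s" "x0 + exp (k * s) *\<^sub>R v s"]
      by (simp add: scaleR_diff_right)
    also have "\<dots> \<le> L * (exp (k * s) * norm (u - v))"
      using L norm_bounded[of "u - v" s] by (intro mult_left_mono) auto
    finally show ?thesis by (simp add: mult_ac)
  qed
  have E_bound: "norm (E u s) \<le> (norm (f x0) + L * norm u) * exp (k * s)" if s: "s \<ge> 0" for u s
  proof -
    have "E 0 s = f x0" by (simp add: E_def)
    hence "norm (E u s) \<le> norm (f x0) * 1 + L * norm u * exp (k * s)"
      using E_diff[of u s 0] norm_triangle_sub[of "E u s" "f x0"] by simp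
    also have "\<dots> \<le> norm (f x0) * exp (k * s) + L * norm u * exp (k * s)"
      using s k by (intro add_right_mono mult_left_mono) auto
    finally show ?thesis by (simp add: distrib_right)
  qed
  have "T u \<in> bcontfun" for u
  proof (rule bcontfun_normI)
    have "continuous_on {0..} (\<lambda>t. integral {0..t} (E u))"
      unfolding continuous_on_eq_continuous_within
      using integral_has_vector_derivative_atLeast[OF contE] has_vector_derivative_continuous by fastforce
    hence "continuous_on UNIV (\<lambda>t. integral {0..max 0 t} (E u))"
      by (rule continuous_on_compose2[where f = "max 0"]) (auto intro!: continuous_intros)
    thus "continuous_on UNIV (T u)" unfolding T_def by (intro continuous_intros)
    show "norm (T u t) \<le> (norm (f x0) + L * norm u) / k" for t
      unfolding T_def by (rule norm_weighted_integral_le[OF contE k(1)]) (auto intro: E_bound)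
  qed
  hence apply_T: "apply_bcontfun (Bcontfun (T u)) = T u" for u
    by (rule Bcontfun_inverse)
  have contraction: "dist (Bcontfun (T u)) (Bcontfun (T v)) \<le> L / k * dist u v" for u v
  proof (rule dist_bound)
    fix t
    have int: "E w integrable_on {0..max 0 t}" for w
      by (intro integrable_continuous_real continuous_on_subset[OF contE]) auto
    have "T u t - T v t = exp (- k * max 0 t) *\<^sub>R integral {0..max 0 t} (\<lambda>s. E u s - E v s)"
      unfolding T_def integral_diff[OF int int] by (simp add: scaleR_diff_right)
    also have "norm \<dots> \<le> L * norm (u - v) / k"
      by (rule norm_weighted_integral_le[OF continuous_on_diff[OF contE contE] k(1)]) (auto intro: E_diff)
    finally show "dist (Bcontfun (T u) t) (Bcontfun (T v) t) \<le> L / k * dist u v"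
      by (simp add: apply_T dist_norm)
  qed
  have "\<exists>!u. Bcontfun (T u) = u"
    using contraction L k by (intro banach_fix_type[of "L / k"]) auto
  then obtain u where "Bcontfun (T u) = u" by blast
  hence u: "apply_bcontfun u = T u" by (metis apply_T)
  define x where "x = (\<lambda>t. x0 + integral {0..t} (E u))"
  have x: "x t = x0 + exp (k * t) *\<^sub>R u t" if "t \<ge> 0" for t
    using that unfolding u by (simp add: x_def T_def exp_minus)
  show ?thesis
  proof
    show "x 0 = x0" by (simp add: x_def)
    fix t :: real assume t: "t \<ge> 0"
    have "(x has_vector_derivative 0 + E u t) (at t within {0..})"
      unfolding x_def
      by (intro has_vector_derivative_add has_vector_derivative_const
          integral_has_vector_derivative_atLeast[OF contE] t)
    thus "(x has_vector_derivative f (x t)) (at t within {0..})"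
      by (simp add: E_def x[OF t])
  qed
qed

section \<open>Concavity and the maximum\<close>

lemma bounded_bilinear_matrix_vector_mult:
  "bounded_bilinear ((*v) :: real^'n^'m \<Rightarrow> real^'n \<Rightarrow> real^'m)"
  by (subst bilinear_conv_bounded_bilinear[symmetric])
     (auto simp: bilinear_def linear_iff algebra_simps scaleR_matrix_vector_assoc)

lemma convex_SPD: "convex SPD"
proof (rule convexI)
  fix A B :: "real^'n^'n" and u v :: real
  assume A: "A \<in> SPD" and B: "B \<in> SPD" and uv: "0 \<le> u" "0 \<le> v" "u + v = 1"
  have "x \<bullet> ((u *\<^sub>R A + v *\<^sub>R B) *v x) > 0" if "x \<noteq> 0" for x
  proof -
    have "x \<bullet> ((u *\<^sub>R A + v *\<^sub>R B) *v x) = u * (x \<bullet> (A *v x)) + v * (x \<bullet> (B *v x))"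
      by (simp add: matrix_vector_mult_add_rdistrib inner_add_right flip: scaleR_matrix_vector_assoc)
    moreover have "u > 0 \<or> v > 0" using uv by linarith
    ultimately show ?thesis
      using uv SPD_pos[OF A that] SPD_pos[OF B that]
      by (metis add_nonneg_pos add_pos_nonneg less_eq_real_def mult_nonneg_nonneg mult_pos_pos)
  qed
  moreover have "u *\<^sub>R A + v *\<^sub>R B \<in> Sym"
    by (intro subspace_add subspace_scale subspace_Sym SPD_imp_Sym A B)
  ultimately show "u *\<^sub>R A + v *\<^sub>R B \<in> SPD" by (simp add: SPD_def Sym_def)
qed

text \<open>A perturbation changes the form by at most \<open>norm (Q - P) * K\<close> times the
  squared norm, which the coercivity constant \<open>\<mu>\<close> of \<open>P\<close> absorbs below
  the radius \<open>\<mu> / K\<close>.\<close>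

lemma SPD_open_in_Sym:
  fixes P :: "real^'n^'n"
  assumes P: "P \<in> SPD"
  obtains e where "e > 0" "\<And>Q. Q \<in> Sym \<Longrightarrow> norm (Q - P) < e \<Longrightarrow> Q \<in> SPD"
proof -
  obtain \<mu> where \<mu>: "\<mu> > 0" "\<And>x. (P *v x) \<bullet> x \<ge> \<mu> * (norm x)\<^sup>2"
    using positive_form_coercive[of "(*v) P"] SPD_pos[OF P]
    by (metis inner_commute matrix_vector_mul_linear)
  obtain K where K: "K > 0" "\<And>(A::real^'n^'n) x. norm (A *v x) \<le> norm A * norm x * K"
    using bounded_bilinear.pos_bounded[OF bounded_bilinear_matrix_vector_mult] by blast
  show ?thesis
  proof
    show "\<mu> / K > 0" using \<mu> K by simp
    fix Q :: "real^'n^'n" assume Q: "Q \<in> Sym" "norm (Q - P) < \<mu> / K"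
    have "x \<bullet> (Q *v x) > 0" if x: "x \<noteq> 0" for x
    proof -
      have "\<bar>((Q - P) *v x) \<bullet> x\<bar> \<le> norm ((Q - P) *v x) * norm x" by (rule Cauchy_Schwarz_ineq2)
      also have "\<dots> \<le> (norm (Q - P) * norm x * K) * norm x" by (intro mult_right_mono K) auto
      also have "\<dots> = (norm (Q - P) * K) * (norm x)\<^sup>2" by (simp add: power2_eq_square)
      also have "\<dots> < \<mu> * (norm x)\<^sup>2"
        using Q(2) K(1) x by (intro mult_strict_right_mono) (auto simp: pos_less_divide_eq)
      finally have "((Q - P) *v x) \<bullet> x > - (\<mu> * (norm x)\<^sup>2)" by linarith
      thus ?thesis using \<mu>(2)[of x]
        by (simp add: matrix_vector_mult_diff_rdistrib inner_diff_left inner_diff_right inner_commute)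
    qed
    with Q(1) show "Q \<in> SPD" by (simp add: SPD_def Sym_def)
  qed
qed

text \<open>A null vector of a semidefinite form lies in its kernel. A limit of positive definite
  matrices is only semidefinite, and this returns it to the cone once its determinant is known to be
  nonzero.\<close>

lemma SPD_if_nonneg_invertible:
  fixes P :: "real^'n^'n"
  assumes P: "P \<in> Sym" "invertible P" and nonneg: "\<And>x. x \<bullet> (P *v x) \<ge> 0"
  shows "P \<in> SPD"
proof -
  have "x \<bullet> (P *v x) > 0" if x: "x \<noteq> 0" for x
  proof (rule ccontr)
    assume "\<not> ?thesis"
    hence 0: "(P *v x) \<bullet> x = 0" using nonneg[of x] by (simp add: inner_commute)
    have "(P *v x) \<bullet> (P *v x) = 0"
      by (rule nonneg_form_null_imp_orthogonal[of "(*v) P" UNIV])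
         (use 0 nonneg Sym_inner_sym[OF P(1)] in \<open>auto simp: inner_commute\<close>)
    hence "P *v x = P *v 0" by simp
    thus False using x inj_matrix_vector_mult[OF P(2)] by (metis injD)
  qed
  with P(1) show ?thesis by (simp add: SPD_def Sym_def)
qed

context spd_pair begin

abbreviation "gF P \<equiv> proj (grad P)"

lemma gmet_gF: "X \<in> Sym \<Longrightarrow> gmet (gF P) X = gmet (grad P) X"
  by (rule metric_proj)

lemma Sym_diff_SPD: "P \<in> SPD \<Longrightarrow> Q \<in> SPD \<Longrightarrow> P - Q \<in> Sym"
  by (intro subspace_diff subspace_Sym SPD_imp_Sym)

lemma segment_SPD:
  assumes "P \<in> SPD" "Q \<in> SPD" "0 \<le> s" "s \<le> 1" shows "Q + s *\<^sub>R (P - Q) \<in> SPD"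
proof -
  have "Q + s *\<^sub>R (P - Q) = (1 - s) *\<^sub>R Q + s *\<^sub>R P" by (simp add: algebra_simps)
  thus ?thesis using convexD[OF convex_SPD assms(2,1), of "1 - s" s] assms(3,4) by simp
qed

text \<open>The mean value theorem for \<open>\<phi>\<close>, the gradient along the segment from
  \<open>Q\<close> to \<open>P\<close> paired with its direction, whose derivative is the Hessian in
  that direction.\<close>

lemma gF_strongly_monotone:
  assumes hb: "hess_bound S0 S1 \<alpha>" and P: "P \<in> SPD" and Q: "Q \<in> SPD"
  shows "gmet (gF P - gF Q) (P - Q) \<le> - \<alpha> * gmet (P - Q) (P - Q)"
proof -
  define X where "X = P - Q"
  have X: "X \<in> Sym" unfolding X_def by (rule Sym_diff_SPD[OF P Q])
  define \<phi> where "\<phi> = (\<lambda>s. gmet (cone_grad S0 F (Q + s *\<^sub>R X)) X)"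
  have der: "(\<phi> has_real_derivative cone_hess S0 F (Q + s *\<^sub>R X) X X) (at s)"
    if "0 \<le> s" "s \<le> 1" for s
  proof -
    have R: "Q + s *\<^sub>R X \<in> SPD" unfolding X_def by (rule segment_SPD[OF P Q that])
    have "((\<lambda>h. gmet (cone_grad S0 F (Q + s *\<^sub>R X + h *\<^sub>R X)) X) has_vector_derivative
        gmet (proj (grad_deriv (Q + s *\<^sub>R X) X)) X) (at 0)"
      by (rule bounded_linear.has_vector_derivative[OF gmet.bounded_linear_left
            has_vector_derivative_cone_grad_line[OF R X]])
    hence "((\<lambda>h. \<phi> (h + s)) has_real_derivative cone_hess S0 F (Q + s *\<^sub>R X) X X) (at 0)"
      by (simp add: \<phi>_def algebra_simps cone_hess_eq_metric[OF R X]
          has_real_derivative_iff_has_vector_derivative)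
    \<comment> \<open>The covariant derivative is taken at parameter 0 of a line, so the derivative
      at \<open>s\<close> is obtained by rebasing the line at
      \<open>Q + s *\<^sub>R X\<close>.\<close>
    thus ?thesis using DERIV_shift[of \<phi> _ 0 s] by simp
  qed
  obtain z where z: "0 < z" "z < 1" "\<phi> 1 - \<phi> 0 = (1 - 0) * cone_hess S0 F (Q + z *\<^sub>R X) X X"
    using MVT2[of 0 1 \<phi> "\<lambda>s. cone_hess S0 F (Q + s *\<^sub>R X) X X"] der by auto
  have "Q + z *\<^sub>R X \<in> SPD" unfolding X_def using z by (intro segment_SPD[OF P Q]) auto
  hence "- cone_hess S0 F (Q + z *\<^sub>R X) X X \<ge> \<alpha> * gmet X X"
    using hb X by (auto simp: hess_bound_def)
  moreover have "\<phi> 1 - \<phi> 0 = gmet (gF P - gF Q) X"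
    by (simp add: \<phi>_def X_def cone_grad_eq SPD_invertible P Q gmet.diff_left)
  ultimately show ?thesis using z(3) by (simp add: X_def)
qed

text \<open>\<open>\<psi>\<close> is \<open>F\<close> along the segment minus its tangent line, plus
  the parabola to be beaten. Strong monotonicity makes its derivative nonpositive, and the claim
  compares its endpoints.\<close>

lemma lift_entropy_strongly_concave:
  assumes hb: "hess_bound S0 S1 \<alpha>" and P: "P \<in> SPD" and Q: "Q \<in> SPD"
  shows "F Q \<le> F P + gmet (gF P) (Q - P) - \<alpha> / 2 * gmet (Q - P) (Q - P)"
proof -
  define X where "X = Q - P"
  have X: "X \<in> Sym" unfolding X_def by (rule Sym_diff_SPD[OF Q P])
  define \<psi> where "\<psi> = (\<lambda>s. F (P + s *\<^sub>R X) - s * gmet (gF P) X + \<alpha> / 2 * s\<^sup>2 * gmet X X)"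
  have "\<psi> 1 \<le> \<psi> 0"
  proof (rule DERIV_nonpos_imp_nonincreasing[of 0 1 \<psi>])
    fix s :: real assume s: "0 \<le> s" "s \<le> 1"
    have R: "P + s *\<^sub>R X \<in> SPD" unfolding X_def by (rule segment_SPD[OF Q P s])
    have "((\<lambda>s. P + s *\<^sub>R X) has_derivative (\<lambda>h. h *\<^sub>R X)) (at s)"
      by (auto intro!: derivative_eq_intros)
    from has_derivative_compose[OF this has_derivative_lift_entropy[OF SPD_invertible[OF R]]]
    have "((\<lambda>s. F (P + s *\<^sub>R X)) has_real_derivative gmet (gF (P + s *\<^sub>R X)) X) (at s)"
      by (simp add: has_field_derivative_def gmet.scaleR_right gmet_gF[OF X] mult.commute[of _ "gmet _ _"])
    hence "(\<psi> has_real_derivative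
        gmet (gF (P + s *\<^sub>R X)) X - gmet (gF P) X + \<alpha> * s * gmet X X) (at s)"
      unfolding \<psi>_def by (auto intro!: derivative_eq_intros)
    moreover have "gmet (gF (P + s *\<^sub>R X)) X - gmet (gF P) X + \<alpha> * s * gmet X X \<le> 0"
    proof (cases "s = 0")
      case False
      \<comment> \<open>The displacement here is \<open>s *\<^sub>R X\<close>; dividing by
        \<open>s > 0\<close> gives the sign of the derivative.\<close>
      have "gmet (gF (P + s *\<^sub>R X) - gF P) (s *\<^sub>R X) \<le> - \<alpha> * gmet (s *\<^sub>R X) (s *\<^sub>R X)"
        using gF_strongly_monotone[OF hb R P] by simp
      hence "s * (gmet (gF (P + s *\<^sub>R X)) X - gmet (gF P) X + \<alpha> * s * gmet X X) \<le> 0"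
        by (simp add: gmet.scaleR_right gmet.scaleR_left gmet.diff_left algebra_simps)
      thus ?thesis using False s by (simp add: mult_le_0_iff)
    qed simp
    ultimately show "\<exists>y. (\<psi> has_real_derivative y) (at s) \<and> y \<le> 0" by blast
  qed simp
  thus ?thesis by (simp add: \<psi>_def X_def)
qed

lemma lift_entropy_le_0:
  assumes P: "P \<in> SPD"
  shows "F P \<le> 0" and "F P = 0 \<longleftrightarrow> P ** S0 ** P = S1"
proof -
  obtain R where R: "R \<in> SPD" "R ** R = I1" by (rule SPD_square_root[OF I1])
  define M where "M = P ** S0 ** P"
  \<comment> \<open>\<open>I1 ** M\<close> is in general not symmetric. Written as
    \<open>R ** R ** M\<close>, it has the same trace and determinant as \<open>R ** M ** R\<close>,
    which is positive definite.\<close>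
  define B where "B = R ** M ** R"
  have "P ** S0 ** transpose P \<in> SPD" by (rule SPD_congruence[OF S0 SPD_invertible[OF P]])
  hence "M \<in> SPD" by (simp add: M_def transpose_SPD[OF P])
  hence "R ** M ** transpose R \<in> SPD" by (rule SPD_congruence[OF _ SPD_invertible[OF R(1)]])
  hence B: "B \<in> SPD" by (simp add: B_def transpose_SPD[OF R(1)])
  have eq: "I1 ** P ** S0 ** transpose P = R ** (R ** M)"
    by (simp add: M_def transpose_SPD[OF P] matrix_mul_assoc R(2))
  have tr: "trace (I1 ** P ** S0 ** transpose P) = trace B"
    unfolding eq B_def by (rule trace_mul_sym)
  have det: "det (I1 ** P ** S0 ** transpose P) = det B"
    unfolding eq B_def by (simp add: det_mul)
  have FP: "F P = real CARD('n) / 2 - 1/2 * trace B + 1/2 * ln (det B)"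
    by (simp add: lift_entropy_def tr det)
  show "F P \<le> 0" using SPD_ln_det_le[OF B] FP by simp
  show "F P = 0 \<longleftrightarrow> P ** S0 ** P = S1"
  proof
    assume "F P = 0"
    hence "B = mat 1" using FP by (intro SPD_ln_det_eq[OF B]) simp
    hence "R ** (M ** R) = mat 1" by (simp add: B_def matrix_mul_assoc)
    hence "M ** R ** R = mat 1" by (simp add: matrix_left_right_inverse)
    hence "M ** I1 = mat 1" by (simp add: R(2) flip: matrix_mul_assoc)
    hence "M ** (I1 ** S1) = S1" by (simp add: matrix_mul_assoc)
    thus "P ** S0 ** P = S1" by (simp add: inv_mults M_def)
  next
    assume "P ** S0 ** P = S1"
    hence "I1 ** P ** S0 ** transpose P = mat 1"
      using inv_mults(4) transpose_SPD[OF P] by (simp flip: matrix_mul_assoc)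
    thus "F P = 0" by (simp add: lift_entropy_def trace_I)
  qed
qed

text \<open>With \<open>X = P - Q\<close> the equation reads
  \<open>P ** S0 ** X + X ** S0 ** Q = 0\<close>. Pairing it with \<open>S0 ** X ** S0\<close> turns
  each summand into a positive definite form, at \<open>S0 ** X\<close> and at
  \<open>X ** S0\<close>.\<close>

lemma equation_unique:
  assumes P: "P \<in> SPD" and Q: "Q \<in> SPD" and eq: "P ** S0 ** P = Q ** S0 ** Q"
  shows "P = Q"
proof (rule ccontr)
  define X where "X = P - Q"
  assume "P \<noteq> Q"
  hence X: "X \<noteq> 0" by (simp add: X_def)
  hence X1: "S0 ** X \<noteq> 0" "X ** S0 \<noteq> 0"
    using inner_mult_SPD_pos[OF S0 X] matrix_inv_cancel[OF SPD_invertible[OF S0], of X]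
    by (auto simp: matrix_mult.zero_right)
  have "P ** S0 ** X + X ** S0 ** Q = 0"
    using eq by (simp add: X_def matrix_mult.diff_left matrix_mult.diff_right)
  hence "(P ** S0 ** X) \<bullet> (S0 ** X ** S0) + (X ** S0 ** Q) \<bullet> (S0 ** X ** S0) = 0"
    by (metis inner_add_left inner_zero_left)
  moreover have "(P ** S0 ** X) \<bullet> (S0 ** X ** S0) = (P ** (S0 ** X) ** S0) \<bullet> (S0 ** X)"
    by (subst inner_matrix_mult_right[of _ S0]) (simp add: transposes matrix_mul_assoc)
  moreover have "(X ** S0 ** Q) \<bullet> (S0 ** X ** S0) = (S0 ** (X ** S0) ** Q) \<bullet> (X ** S0)"
  proof -
    have "(S0 ** (X ** S0 ** Q)) \<bullet> (X ** S0) = (X ** S0 ** Q) \<bullet> (S0 ** (X ** S0))"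
      by (subst inner_matrix_mult_left) (simp add: transposes)
    thus ?thesis by (simp add: matrix_mul_assoc)
  qed
  ultimately show False
    using SPD_mult_both_inner_pos[OF P S0 X1(1)] SPD_mult_both_inner_pos[OF S0 Q X1(2)] by simp
qed

text \<open>The witness \<open>Ri ** T ** Ri\<close> is the geometric mean of the inverse of
  \<open>S0\<close> with \<open>S1\<close>, known as the matrix of the optimal transport map between
  centred Gaussians with covariances \<open>S0\<close> and \<open>S1\<close>.\<close>

lemma equation_solvable: "\<exists>P\<in>SPD. P ** S0 ** P = S1"
proof -
  obtain R where R: "R \<in> SPD" "R ** R = S0" by (rule SPD_square_root[OF S0])
  define Ri where "Ri = matrix_inv R"
  have Ri: "Ri \<in> SPD" "R ** Ri = mat 1" "Ri ** R = mat 1"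
    using R(1) by (simp_all add: Ri_def SPD_matrix_inv matrix_inv_mult SPD_invertible)
  have "R ** S1 ** transpose R \<in> SPD" by (rule SPD_congruence[OF S1 SPD_invertible[OF R(1)]])
  hence "R ** S1 ** R \<in> SPD" by (simp add: transpose_SPD[OF R(1)])
  then obtain T where T: "T \<in> SPD" "T ** T = R ** S1 ** R" by (rule SPD_square_root)
  have "Ri ** T ** transpose Ri \<in> SPD" by (rule SPD_congruence[OF T(1) SPD_invertible[OF Ri(1)]])
  hence "Ri ** T ** Ri \<in> SPD" by (simp add: transpose_SPD[OF Ri(1)])
  moreover have "Ri ** T ** Ri ** S0 ** (Ri ** T ** Ri) = S1"
  proof -
    have "Ri ** T ** Ri ** S0 ** (Ri ** T ** Ri) = Ri ** T ** (Ri ** R) ** (R ** Ri) ** T ** Ri"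
      by (simp add: R(2)[symmetric] matrix_mul_assoc)
    also have "\<dots> = Ri ** (T ** T) ** Ri" by (simp add: Ri matrix_mul_assoc)
    also have "\<dots> = (Ri ** R) ** S1 ** (R ** Ri)" by (simp add: T(2) matrix_mul_assoc)
    finally show ?thesis by (simp add: Ri)
  qed
  ultimately show ?thesis by blast
qed

definition Pinf :: "real^'n^'n" where "Pinf = (SOME P. P \<in> SPD \<and> P ** S0 ** P = S1)"

lemma Pinf: "Pinf \<in> SPD" "Pinf ** S0 ** Pinf = S1"
  using someI_ex[OF equation_solvable[unfolded Bex_def]] by (auto simp: Pinf_def)

lemma lift_entropy_Pinf: "F Pinf = 0"
  using lift_entropy_le_0(2)[OF Pinf(1)] Pinf(2) by simp

lemma is_arg_max_lift_entropy: "is_arg_max F (\<lambda>P. P \<in> SPD) Q \<longleftrightarrow> Q = Pinf"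
proof
  assume Q: "is_arg_max F (\<lambda>P. P \<in> SPD) Q"
  hence QS: "Q \<in> SPD" by (simp add: is_arg_max_def)
  have "F Q \<ge> 0" using Q Pinf(1) lift_entropy_Pinf by (force simp: is_arg_max_def)
  hence "Q ** S0 ** Q = S1" using lift_entropy_le_0[OF QS] by simp
  thus "Q = Pinf" using equation_unique[OF QS Pinf(1)] Pinf(2) by simp
next
  assume "Q = Pinf"
  thus "is_arg_max F (\<lambda>P. P \<in> SPD) Q"
    using Pinf(1) lift_entropy_le_0(1) by (auto simp: is_arg_max_def lift_entropy_Pinf not_less)
qed

text \<open>Already the ambient gradient vanishes: the equation for \<open>Pinf\<close> rearranges
  to \<open>matrix_inv Pinf ** I0 = I1 ** Pinf\<close>.\<close>

lemma gF_Pinf: "gF Pinf = 0"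
proof -
  note inv = matrix_inv_mult[OF SPD_invertible[OF Pinf(1)]]
  have "Pinf ** S0 ** Pinf ** (matrix_inv Pinf ** I0) = Pinf ** S0 ** (Pinf ** matrix_inv Pinf) ** I0"
    by (simp add: matrix_mul_assoc)
  also have "\<dots> = Pinf ** (S0 ** I0)" unfolding inv by (simp add: matrix_mul_assoc)
  finally have 1: "S1 ** (matrix_inv Pinf ** I0) = Pinf" unfolding Pinf(2) by (simp add: inv_mults)
  have "matrix_inv Pinf ** I0 = I1 ** (S1 ** (matrix_inv Pinf ** I0))"
    by (simp add: matrix_inv_cancel SPD_invertible S1)
  hence "grad Pinf = 0"
    unfolding 1 by (simp add: grad_def transpose_SPD[OF SPD_matrix_inv[OF Pinf(1)]])
  thus ?thesis using linear_0[OF bounded_linear.linear[OF bounded_linear_proj]] by simp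
qed

text \<open>A Polyak-Lojasiewicz inequality. Strong concavity is evaluated at the maximiser, where
  \<open>F\<close> is 0, and the square of \<open>g - \<alpha> *\<^sub>R X\<close> eliminates the
  unknown displacement \<open>X\<close>.\<close>

lemma gF_gradient_dominates:
  assumes "\<alpha> > 0" "hess_bound S0 S1 \<alpha>" "P \<in> SPD"
  shows "- 2 * \<alpha> * F P \<le> gmet (gF P) (gF P)"
proof -
  define g X where "g = gF P" and "X = Pinf - P"
  have "0 \<le> F P + gmet g X - \<alpha> / 2 * gmet X X"
    using lift_entropy_strongly_concave[OF assms(2,3) Pinf(1)]
    by (simp add: lift_entropy_Pinf g_def X_def)
  hence "0 \<le> (2 * \<alpha>) * (F P + gmet g X - \<alpha> / 2 * gmet X X)" using assms(1) by simp
  moreover have "0 \<le> gmet (g - \<alpha> *\<^sub>R X) (g - \<alpha> *\<^sub>R X)" by (rule metric_nonneg)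
  ultimately show ?thesis unfolding g_def[symmetric]
    by (simp add: gmet.diff_left gmet.diff_right gmet.scaleR_left gmet.scaleR_right
        metric_commute[of X g] algebra_simps)
qed

end

section \<open>The flow\<close>

text \<open>Strictly between \<open>a\<close> and \<open>b\<close> the derivative within the
  half-line is two-sided; at the endpoints only continuity matters, so the one-sided derivative at
  time 0 is enough.\<close>

lemma has_real_derivative_nonneg_imp_le:
  fixes f :: "real \<Rightarrow> real"
  assumes ab: "0 \<le> a" "a \<le> b"
    and der: "\<And>t. a \<le> t \<Longrightarrow> t \<le> b \<Longrightarrow> (f has_real_derivative f' t) (at t within {0..})"
    and nonneg: "\<And>t. a \<le> t \<Longrightarrow> t \<le> b \<Longrightarrow> f' t \<ge> 0"
  shows "f a \<le> f b"
proof (rule DERIV_nonneg_imp_increasing_open[OF ab(2)])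
  fix t assume t: "a < t" "t < b"
  have "at t within {0..} = at t" using t ab(1) by (intro at_within_interior) simp
  thus "\<exists>y. DERIV f t :> y \<and> 0 \<le> y" using der[of t] nonneg[of t] t by auto
next
  have "continuous_on {a..b} f" unfolding continuous_on_eq_continuous_within
  proof
    fix t assume t: "t \<in> {a..b}"
    hence "continuous (at t within {0..}) f"
      using der[of t] by (auto intro: has_field_derivative_imp_has_derivative has_derivative_continuous)
    thus "continuous (at t within {a..b}) f"
      by (rule continuous_within_subset) (use ab in auto)
  qed
  thus "continuous_on {a..b} f" .
qed

lemma exp_minus_mult_cancel: "exp (- 2 * a * t) * (exp (2 * a * t) * y) = (y::real)"
  by (simp flip: mult.assoc exp_add)

context spd_pair begin

section \<open>Exponential estimates and convergence along trajectories\<close>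

lemma lift_dist_sq: "(lift_dist S0 A B)\<^sup>2 = gmet (A - B) (A - B)"
  using metric_nonneg[of "A - B"] by (simp add: lift_dist_def lift_metric_def)

lemma has_real_derivative_entropy_along:
  assumes P: "P t \<in> SPD" and der: "(P has_vector_derivative v) (at t within S)"
  shows "((\<lambda>t. F (P t)) has_real_derivative gmet (grad (P t)) v) (at t within S)"
proof -
  have "((\<lambda>t. F (P t)) has_derivative (\<lambda>h. gmet (grad (P t)) (h *\<^sub>R v))) (at t within S)"
    using der[unfolded has_vector_derivative_def] has_derivative_lift_entropy[OF SPD_invertible[OF P]]
    by (rule has_derivative_compose)
  thus ?thesis
    by (simp add: has_field_derivative_def gmet.scaleR_right mult.commute[of _ "gmet _ _"])
qed

lemma flow_solution_D:
  assumes "flow_solution S0 S1 P0 P" "t \<ge> 0"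
  shows "P t \<in> SPD" "(P has_vector_derivative gF (P t)) (at t within {0..})"
  using assms by (auto simp: flow_solution_def flow_field_eq)

text \<open>Along the flow \<open>F\<close> grows at the rate of the squared gradient, so gradient
  domination makes \<open>exp (2 * \<alpha> * t) * F (P t)\<close> nondecreasing. As
  \<open>F\<close> is nonpositive with maximum 0, this lower bound is exponential decay of the
  entropy gap.\<close>

lemma flow_entropy_estimate:
  assumes P: "flow_solution S0 S1 P0 P" and \<alpha>: "\<alpha> > 0" "hess_bound S0 S1 \<alpha>" and t: "t \<ge> 0"
  shows "F (P t) \<ge> exp (- 2 * \<alpha> * t) * F P0"
proof -
  let ?h = "\<lambda>t. exp (2 * \<alpha> * t) * F (P t)"
  have "?h 0 \<le> ?h t"
  proof (rule has_real_derivative_nonneg_imp_le[OF order_refl t])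
    fix s :: real assume s: "0 \<le> s"
    note D = flow_solution_D[OF P s]
    have "gmet (grad (P s)) (gF (P s)) = gmet (gF (P s)) (gF (P s))"
      by (simp add: gmet_gF tangent_proj_Sym)
    hence "((\<lambda>t. F (P t)) has_real_derivative gmet (gF (P s)) (gF (P s))) (at s within {0..})"
      using has_real_derivative_entropy_along[OF D] by simp
    thus "(?h has_real_derivative
        exp (2 * \<alpha> * s) * (2 * \<alpha> * F (P s) + gmet (gF (P s)) (gF (P s)))) (at s within {0..})"
      by (auto intro!: derivative_eq_intros simp: algebra_simps)
    show "exp (2 * \<alpha> * s) * (2 * \<alpha> * F (P s) + gmet (gF (P s)) (gF (P s))) \<ge> 0"
      using gF_gradient_dominates[OF \<alpha> D(1)] by simp
  qed
  moreover have "P 0 = P0" using P by (simp add: flow_solution_def)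
  ultimately have "exp (- 2 * \<alpha> * t) * F P0 \<le> exp (- 2 * \<alpha> * t) * (exp (2 * \<alpha> * t) * F (P t))"
    by (intro mult_left_mono) auto
  thus ?thesis unfolding exp_minus_mult_cancel .
qed

text \<open>\<open>Pinf\<close> is a zero of the field, so strong monotonicity between
  \<open>P t\<close> and \<open>Pinf\<close> bounds the derivative of the squared distance by
  \<open>- 2 * \<alpha>\<close> times itself. The sign of \<open>?h\<close> turns this decay into
  the growth expected by the monotonicity lemma.\<close>

lemma flow_distance_estimate:
  assumes P: "flow_solution S0 S1 P0 P" and \<alpha>: "\<alpha> > 0" "hess_bound S0 S1 \<alpha>" and t: "t \<ge> 0"
  shows "(lift_dist S0 (P t) Pinf)\<^sup>2 \<le> exp (- 2 * \<alpha> * t) * (lift_dist S0 P0 Pinf)\<^sup>2"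
proof -
  let ?d = "\<lambda>t. gmet (P t - Pinf) (P t - Pinf)"
  let ?h = "\<lambda>t. - (exp (2 * \<alpha> * t) * ?d t)"
  have "?h 0 \<le> ?h t"
  proof (rule has_real_derivative_nonneg_imp_le[OF order_refl t])
    fix s :: real assume s: "0 \<le> s"
    note D = flow_solution_D[OF P s]
    let ?g = "gmet (gF (P s)) (P s - Pinf)"
    have 1: "((\<lambda>t. P t - Pinf) has_vector_derivative gF (P s)) (at s within {0..})"
      using D(2) by (auto intro!: derivative_eq_intros)
    have "(?d has_real_derivative 2 * ?g) (at s within {0..})"
      using gmet.has_vector_derivative[OF 1 1]
      by (simp add: has_real_derivative_iff_has_vector_derivative metric_commute[of "P s - Pinf"])
    thus "(?h has_real_derivative
        - exp (2 * \<alpha> * s) * (2 * (\<alpha> * ?d s + ?g))) (at s within {0..})"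
      by (auto intro!: derivative_eq_intros simp: algebra_simps)
    have "?g \<le> - \<alpha> * ?d s"
      using gF_strongly_monotone[OF \<alpha>(2) D(1) Pinf(1)] by (simp add: gF_Pinf)
    thus "- exp (2 * \<alpha> * s) * (2 * (\<alpha> * ?d s + ?g)) \<ge> 0"
      by (simp add: mult_le_0_iff)
  qed
  hence "exp (2 * \<alpha> * t) * ?d t \<le> ?d 0" by simp
  moreover have "P 0 = P0" using P by (simp add: flow_solution_def)
  ultimately have "exp (- 2 * \<alpha> * t) * (exp (2 * \<alpha> * t) * ?d t)
      \<le> exp (- 2 * \<alpha> * t) * gmet (P0 - Pinf) (P0 - Pinf)"
    by (intro mult_left_mono) auto
  thus ?thesis unfolding exp_minus_mult_cancel lift_dist_sq .
qed

text \<open>The distance estimate for some admissible constant, transferred from the metric to the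
  norm by coercivity.\<close>

lemma flow_converges:
  assumes P: "flow_solution S0 S1 P0 P" shows "(P \<longlongrightarrow> Pinf) at_top"
proof -
  obtain \<alpha> where \<alpha>: "\<alpha> > 0" "hess_bound S0 S1 \<alpha>" using hess_bound_exists by blast
  obtain \<mu> where \<mu>: "\<mu> > 0" "\<And>X. gmet X X \<ge> \<mu> * (norm X)\<^sup>2" by (rule metric_coercive) blast
  define C where "C = (lift_dist S0 P0 Pinf)\<^sup>2 / \<mu>"
  have "(norm (P t - Pinf))\<^sup>2 \<le> C * exp (- 2 * \<alpha> * t)" if "t \<ge> 0" for t
  proof -
    have "\<mu> * (norm (P t - Pinf))\<^sup>2 \<le> exp (- 2 * \<alpha> * t) * (lift_dist S0 P0 Pinf)\<^sup>2"
      using order_trans[OF \<mu>(2) flow_distance_estimate[OF P \<alpha> that, unfolded lift_dist_sq[of "P t"]]] .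
    thus ?thesis using \<mu>(1) by (simp add: C_def field_simps)
  qed
  hence le: "\<forall>\<^sub>F t in at_top. (norm (P t - Pinf))\<^sup>2 \<le> C * exp (- 2 * \<alpha> * t)"
    by (rule eventually_mono[OF eventually_ge_at_top[of 0]])
  have "filterlim (\<lambda>t. - 2 * \<alpha> * t) at_bot at_top"
    using \<alpha>(1) filterlim_ident[of at_top]
    by (intro filterlim_tendsto_neg_mult_at_bot[OF tendsto_const]) auto
  hence "((\<lambda>t. exp (- 2 * \<alpha> * t)) \<longlongrightarrow> 0) at_top"
    by (rule filterlim_compose[OF exp_at_bot])
  hence "((\<lambda>t. C * exp (- 2 * \<alpha> * t)) \<longlongrightarrow> 0) at_top"
    by (rule tendsto_mult_right_zero)
  hence "((\<lambda>t. (norm (P t - Pinf))\<^sup>2) \<longlongrightarrow> 0) at_top"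
    by (rule tendsto_sandwich[OF _ le tendsto_const, rotated]) simp
  hence "((\<lambda>t. sqrt ((norm (P t - Pinf))\<^sup>2)) \<longlongrightarrow> sqrt 0) at_top"
    by (rule tendsto_real_sqrt)
  hence "((\<lambda>t. P t - Pinf) \<longlongrightarrow> 0) at_top" by (simp add: tendsto_norm_zero_iff)
  thus ?thesis by (rule LIM_zero_cancel)
qed

section \<open>Superlevel sets and global existence\<close>

definition superlevel :: "real \<Rightarrow> (real^'n^'n) set" where
  "superlevel c = {P \<in> SPD. F P \<ge> c}"

lemma isCont_lift_entropy: "invertible A \<Longrightarrow> isCont F A"
  by (rule has_derivative_continuous[OF has_derivative_lift_entropy])

text \<open>The tangent inequality at the intermediate point \<open>R\<close> is averaged over
  \<open>P\<close> and \<open>Q\<close>, and the linear terms cancel. Convexity makes the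
  closest-point map onto the set single-valued and 1-Lipschitz.\<close>

lemma convex_superlevel: "convex (superlevel c)"
proof (rule convexI)
  fix P Q and u v :: real
  assume P: "P \<in> superlevel c" and Q: "Q \<in> superlevel c" and uv: "0 \<le> u" "0 \<le> v" "u + v = 1"
  define R where "R = u *\<^sub>R P + v *\<^sub>R Q"
  have PQ: "P \<in> SPD" "Q \<in> SPD" "c \<le> F P" "c \<le> F Q"
    using P Q by (auto simp: superlevel_def)
  have R: "R \<in> SPD" unfolding R_def using convexD[OF convex_SPD PQ(1,2) uv] .
  obtain \<alpha> where \<alpha>: "\<alpha> > 0" "hess_bound S0 S1 \<alpha>" using hess_bound_exists by blast
  have "F T \<le> F R + gmet (gF R) (T - R)" if "T \<in> SPD" for T
    using lift_entropy_strongly_concave[OF \<alpha>(2) R that] \<alpha>(1) metric_nonneg[of "T - R"]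
    by (smt (verit) divide_pos_pos mult_nonneg_nonneg)
  from this[OF PQ(1)] this[OF PQ(2)]
  have "u * c + v * c \<le> u * (F R + gmet (gF R) (P - R)) + v * (F R + gmet (gF R) (Q - R))"
    using PQ(3,4) uv by (intro add_mono mult_left_mono) linarith+
  also have "\<dots> = (u + v) * F R + gmet (gF R) (u *\<^sub>R (P - R) + v *\<^sub>R (Q - R))"
    by (simp add: gmet.add_right gmet.scaleR_right distrib_left distrib_right)
  also have "u *\<^sub>R (P - R) + v *\<^sub>R (Q - R) = R - (u + v) *\<^sub>R R"
    by (simp add: R_def algebra_simps)
  finally have "c \<le> F R" using uv(3) by (simp add: gmet.zero_right flip: distrib_right)
  with R show "u *\<^sub>R P + v *\<^sub>R Q \<in> superlevel c" by (simp add: superlevel_def R_def)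
qed

text \<open>Closedness holds in the space of all matrices, not only relative to the cone: the
  entropy bound keeps the determinant away from 0, so a limit is semidefinite and
  invertible.\<close>

lemma closed_superlevel: "closed (superlevel c)"
  unfolding closed_sequential_limits
proof safe
  fix p P assume p: "\<forall>n. p n \<in> superlevel c" and lim: "p \<longlonglongrightarrow> P"
  have pS: "p n \<in> SPD" "c \<le> F (p n)" for n using p by (auto simp: superlevel_def)
  have Sym: "P \<in> Sym"
    using closed_sequentially[OF closed_subspace[OF subspace_Sym] _ lim] pS SPD_imp_Sym by blast
  have nonneg: "x \<bullet> (P *v x) \<ge> 0" for x
  proof (rule LIMSEQ_le_const)
    show "(\<lambda>n. x \<bullet> (p n *v x)) \<longlonglongrightarrow> x \<bullet> (P *v x)"
      by (intro tendsto_intros bounded_bilinear.tendsto[OF bounded_bilinear_matrix_vector_mult] lim)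
    show "\<exists>N. \<forall>n\<ge>N. 0 \<le> x \<bullet> (p n *v x)"
      using SPD_pos[OF pS(1), of x] by (intro exI[of _ 0] allI) (cases "x = 0", auto intro: less_imp_le)
  qed
  define k where "k = det I1 * det S0"
  have k: "k > 0" using det_const_pos by (simp add: k_def)
  have "exp (2 * c - real CARD('n)) \<le> k * (det (p n) * det (p n))" for n
  proof -
    have "det (p n) > 0" by (rule SPD_det_pos[OF pS(1)])
    hence pos: "k * (det (p n) * det (p n)) > 0" using k by simp
    have "0 \<le> (I1 ** p n ** S0) \<bullet> p n"
      using SPD_mult_both_inner_pos[OF I1 S0, of "p n"] by (cases "p n = 0") auto
    \<comment> \<open>The quadratic term only lowers \<open>F\<close>, so discarding it bounds the
      logarithm from below.\<close>
    hence "2 * c - real CARD('n) \<le> ln (k * (det (p n) * det (p n)))"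
      using pS(2)[of n] unfolding lift_entropy_eq k_def by simp
    thus ?thesis using pos by (simp add: ln_ge_iff)
  qed
  moreover have "(\<lambda>n. k * (det (p n) * det (p n))) \<longlonglongrightarrow> k * (det P * det P)"
  proof -
    have "continuous_on UNIV (\<lambda>x::real^'n^'n. det x)" by (intro continuous_intros)
    hence "isCont det P" by (simp add: continuous_on_eq_continuous_at)
    hence "(\<lambda>n. det (p n)) \<longlonglongrightarrow> det P" using lim by (rule isCont_tendsto_compose)
    thus ?thesis by (intro tendsto_intros)
  qed
  ultimately have "exp (2 * c - real CARD('n)) \<le> k * (det P * det P)"
    by (intro LIMSEQ_le_const) auto
  hence "det P \<noteq> 0" using exp_gt_zero[of "2 * c - real CARD('n)"] by (metis mult_zero_right not_le)
  hence inv: "invertible P" by (simp add: invertible_det_nz)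
  have "(\<lambda>n. F (p n)) \<longlonglongrightarrow> F P" by (rule isCont_tendsto_compose[OF isCont_lift_entropy[OF inv] lim])
  hence "c \<le> F P" using pS(2) by (intro LIMSEQ_le_const) auto
  with SPD_if_nonneg_invertible[OF Sym inv nonneg] show "P \<in> superlevel c"
    by (simp add: superlevel_def)
qed

text \<open>Strong concavity at the critical point \<open>Pinf\<close> bounds the squared distance
  to it by the entropy drop; this gives the radius of the ball.\<close>

lemma compact_superlevel: "compact (superlevel c)"
proof -
  obtain \<alpha> where \<alpha>: "\<alpha> > 0" "hess_bound S0 S1 \<alpha>" using hess_bound_exists by blast
  obtain \<mu> where \<mu>: "\<mu> > 0" "\<And>X. gmet X X \<ge> \<mu> * (norm X)\<^sup>2" by (rule metric_coercive) blast
  have "superlevel c \<subseteq> cball Pinf (sqrt (- 2 * c / (\<alpha> * \<mu>)))"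
  proof
    fix P assume P: "P \<in> superlevel c"
    have "c \<le> - \<alpha> / 2 * gmet (P - Pinf) (P - Pinf)"
      using lift_entropy_strongly_concave[OF \<alpha>(2) Pinf(1), of P] P
      by (simp add: superlevel_def lift_entropy_Pinf gF_Pinf gmet.zero_left)
    also have "\<dots> \<le> - \<alpha> / 2 * (\<mu> * (norm (P - Pinf))\<^sup>2)"
      using \<alpha>(1) \<mu>(2) by (intro mult_left_mono_neg) auto
    finally have "(norm (P - Pinf))\<^sup>2 \<le> - 2 * c / (\<alpha> * \<mu>)"
      using \<alpha>(1) \<mu>(1) by (simp add: field_simps)
    hence "norm (P - Pinf) \<le> sqrt (- 2 * c / (\<alpha> * \<mu>))" by (rule real_le_rsqrt)
    thus "P \<in> cball Pinf (sqrt (- 2 * c / (\<alpha> * \<mu>)))" by (simp add: dist_norm norm_minus_commute)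
  qed
  hence "bounded (superlevel c)" using bounded_cball bounded_subset by blast
  thus ?thesis using closed_superlevel by (simp add: compact_eq_bounded_closed)
qed

text \<open>By compactness the inverse is bounded by some \<open>M\<close>, and the resolvent
  identity makes it Lipschitz. In \<open>L\<close>, each \<open>K\<close> accounts for one matrix
  product and \<open>K'\<close> for the projection.\<close>

lemma gF_lipschitz_on_superlevel: obtains L where "L-lipschitz_on (superlevel c) gF"
proof -
  have "superlevel c \<subseteq> {A. invertible A}" by (auto simp: superlevel_def SPD_invertible)
  hence "compact (matrix_inv ` superlevel c)"
    by (intro compact_continuous_image compact_superlevel continuous_on_subset[OF continuous_on_matrix_inv])
  then obtain M where M: "M > 0" "\<And>P. P \<in> superlevel c \<Longrightarrow> norm (matrix_inv P) \<le> M"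
    using compact_imp_bounded bounded_pos by (metis imageI)
  obtain K where K: "K > 0" "\<And>(A::real^'n^'n) (B::real^'n^'n). norm (A ** B) \<le> norm A * norm B * K"
    using matrix_mult.pos_bounded by blast
  obtain K' where K': "K' > 0" "\<And>X. norm (proj X) \<le> norm X * K'"
    using bounded_linear.pos_bounded[OF bounded_linear_proj] by blast
  define L where "L = (M * M * K * K * norm I0 * K + norm I1 * K) * K'"
  have "L-lipschitz_on (superlevel c) gF"
  proof (rule lipschitz_onI)
    show "L \<ge> 0" using M(1) K(1) K'(1) by (simp add: L_def)
    fix P Q assume P: "P \<in> superlevel c" and Q: "Q \<in> superlevel c"
    hence PQ: "P \<in> SPD" "Q \<in> SPD" by (auto simp: superlevel_def)
    define D where "D = matrix_inv P - matrix_inv Q"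
    have "norm D \<le> norm (matrix_inv P ** (Q - P)) * norm (matrix_inv Q) * K"
      unfolding D_def matrix_inv_diff[OF SPD_invertible[OF PQ(1)] SPD_invertible[OF PQ(2)]] by (rule K(2))
    also have "\<dots> \<le> (norm (matrix_inv P) * norm (Q - P) * K) * norm (matrix_inv Q) * K"
      using K by (intro mult_right_mono) auto
    also have "\<dots> \<le> (M * norm (Q - P) * K) * M * K"
      using K(1) M P Q by (intro mult_mono mult_nonneg_nonneg) auto
    finally have D: "norm D \<le> M * M * K * K * norm (P - Q)"
      by (simp add: norm_minus_commute mult_ac)
    have "grad P - grad Q = D ** I0 - I1 ** (P - Q)"
      using transpose_SPD[OF SPD_matrix_inv[OF PQ(1)]] transpose_SPD[OF SPD_matrix_inv[OF PQ(2)]]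
      by (simp add: grad_def D_def matrix_mult.diff_left matrix_mult.diff_right)
    also have "norm \<dots> \<le> norm (D ** I0) + norm (I1 ** (P - Q))" by (rule norm_triangle_ineq4)
    also have "\<dots> \<le> norm D * norm I0 * K + norm I1 * norm (P - Q) * K" by (intro add_mono K(2))
    also have "\<dots> \<le> (M * M * K * K * norm (P - Q)) * norm I0 * K + norm I1 * norm (P - Q) * K"
      using K(1) D by (intro add_right_mono mult_right_mono) auto
    also have "\<dots> = (M * M * K * K * norm I0 * K + norm I1 * K) * norm (P - Q)"
      by (simp add: algebra_simps)
    finally have *: "norm (grad P - grad Q)
        \<le> (M * M * K * K * norm I0 * K + norm I1 * K) * norm (P - Q)" .
    have "norm (gF P - gF Q) = norm (proj (grad P - grad Q))"
      by (simp add: linear_diff[OF bounded_linear.linear[OF bounded_linear_proj]])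
    also have "\<dots> \<le> norm (grad P - grad Q) * K'" by (rule K'(2))
    also have "\<dots> \<le> ((M * M * K * K * norm I0 * K + norm I1 * K) * norm (P - Q)) * K'"
      using K'(1) * by (intro mult_right_mono) auto
    finally show "dist (gF P) (gF Q) \<le> L * dist P Q" by (simp add: L_def dist_norm mult_ac)
  qed
  thus ?thesis by (rule that)
qed

text \<open>The field is cut off outside a superlevel set by composing with the metric projection onto it,
  which is globally Lipschitz; since \<open>F\<close> increases along the flow, a trajectory never
  reaches the region where the cut-off is active.\<close>

lemma flow_exists:
  assumes P0: "P0 \<in> SPD"
  shows "\<exists>P. flow_solution S0 S1 P0 P"
proof -
  define c where "c = F P0"
  \<comment> \<open>The cut-off sits one unit below the initial level \<open>c\<close>. A trajectory
    at level at least \<open>c\<close> thus has room to continue for a short time under the uncut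
    field; any positive gap would do.\<close>
  define C where "C = superlevel (c - 1)"
  define C0 where "C0 = superlevel c"
  have P0C: "P0 \<in> C0" using P0 by (simp add: C0_def superlevel_def c_def)
  have sub: "C0 \<subseteq> C" by (auto simp: C0_def C_def superlevel_def)
  have C: "convex C" "closed C" "C \<noteq> {}"
    using convex_superlevel closed_superlevel P0C sub by (auto simp: C_def)
  have cpC: "closest_point C x \<in> C" for x using C by (intro closest_point_in_set)
  obtain L where L: "L-lipschitz_on C gF" unfolding C_def by (rule gF_lipschitz_on_superlevel)
  define f where "f = (\<lambda>x. gF (closest_point C x))"
  have "1-lipschitz_on UNIV (closest_point C)"
    using closest_point_lipschitz[OF C] by (intro lipschitz_onI) auto
  moreover have "L-lipschitz_on (closest_point C ` UNIV) gF"
    by (rule lipschitz_on_subset[OF L]) (use cpC in auto)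
  ultimately have "(L * 1)-lipschitz_on UNIV f"
    unfolding f_def by (rule lipschitz_on_compose2)
  then obtain x where x0: "x 0 = P0"
    and x: "\<And>t. t \<ge> 0 \<Longrightarrow> (x has_vector_derivative f (x t)) (at t within {0..})"
    by (rule global_lipschitz_ode_solution[where ?x0.0 = P0]) blast
  have contx: "continuous (at t within {0..}) x" if "t \<ge> 0" for t
    using x[OF that] by (rule has_vector_derivative_continuous)
  have fSym: "f y \<in> Sym" for y by (simp add: f_def tangent_proj_Sym)
  \<comment> \<open>The cut-off field has symmetric values, so the skew part of \<open>x\<close>
    stays at its initial value 0. This matters because the cone is open only within
    \<open>Sym\<close>.\<close>
  have xSym: "x t \<in> Sym" if "t \<ge> 0" for t
  proof -
    let ?y = "\<lambda>t. transpose (x t) - x t"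
    have "(?y has_vector_derivative 0) (at s within {0..})" if "s \<in> {0..}" for s
    proof -
      have "(x has_vector_derivative f (x s)) (at s within {0..})" using that by (intro x) simp
      from has_vector_derivative_diff[OF bounded_linear.has_vector_derivative[OF
            bounded_linear_transpose this] this]
      show ?thesis using transpose_Sym[OF fSym] by simp
    qed
    then obtain k where "\<And>s. s \<in> {0..} \<Longrightarrow> ?y s = k"
      by (rule has_vector_derivative_zero_constant[rotated]) auto
    moreover have "?y 0 = 0" using transpose_SPD[OF P0] by (simp add: x0)
    ultimately have "?y t = 0" using that by (metis atLeast_iff order_refl)
    thus ?thesis by (simp add: Sym_def)
  qed
  have "x t \<in> C0" if t: "t \<ge> 0" for t
  proof (rule ccontr)
    \<comment> \<open>A first-exit argument: the infimum \<open>r\<close> of the exit times is still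
      in \<open>C0\<close> by closedness, and the trajectory will be shown to remain in
      \<open>C0\<close> for a time \<open>d\<close> beyond \<open>r\<close>.\<close>
    define S where "S = {t. t \<ge> 0 \<and> x t \<notin> C0}"
    assume "x t \<notin> C0"
    hence ne: "S \<noteq> {}" using t by (auto simp: S_def)
    have bdd: "bdd_below S" by (auto simp: S_def bdd_below_def)
    define r where "r = Inf S"
    have r: "r \<ge> 0" unfolding r_def using ne by (intro cInf_greatest) (auto simp: S_def)
    have before: "x s \<in> C0" if "0 \<le> s" "s < r" for s
    proof (rule ccontr)
      assume "x s \<notin> C0"
      hence "r \<le> s" unfolding r_def using that(1) by (intro cInf_lower bdd) (auto simp: S_def)
      with that(2) show False by simp
    qed
    have xr: "x r \<in> C0"
    proof (cases "r = 0")
      case False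
      have "continuous_on {0..} x"
        using contx by (simp add: continuous_on_eq_continuous_within)
      hence "continuous_on {0..r} x" by (rule continuous_on_subset) auto
      hence "closed ({0..r} \<inter> x -` C0)"
        unfolding C0_def by (intro continuous_closed_preimage closed_superlevel) auto
      moreover have "{0..<r} \<subseteq> {0..r} \<inter> x -` C0" using before by auto
      ultimately have "closure {0..<r} \<subseteq> {0..r} \<inter> x -` C0" by (rule closure_minimal[rotated])
      thus ?thesis using False r by (auto simp: closure_atLeastLessThan)
    qed (simp add: x0 P0C)
    have xrS: "x r \<in> SPD" "c \<le> F (x r)" using xr by (auto simp: C0_def superlevel_def)
    obtain e where e: "e > 0" "\<And>Q. Q \<in> Sym \<Longrightarrow> norm (Q - x r) < e \<Longrightarrow> Q \<in> SPD"
      using SPD_open_in_Sym[OF xrS(1)] by blast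
    have tendsto: "(x \<longlongrightarrow> x r) (at r within {0..})" using contx[OF r] by (simp add: continuous_within)
    have "\<forall>\<^sub>F s in at r within {0..}. norm (x s - x r) < e"
      using tendstoD[OF tendsto e(1)] by (simp add: dist_norm)
    moreover have "\<forall>\<^sub>F s in at r within {0..}. c - 1 < F (x s)"
      using isCont_tendsto_compose[OF isCont_lift_entropy[OF SPD_invertible[OF xrS(1)]] tendsto] xrS(2)
      by (intro order_tendstoD(1)) auto
    ultimately have "\<forall>\<^sub>F s in at r within {0..}. norm (x s - x r) < e \<and> c - 1 < F (x s)"
      by (rule eventually_conj)
    then obtain d where d: "d > 0"
      "\<And>s. s \<ge> 0 \<Longrightarrow> s \<noteq> r \<Longrightarrow> dist s r < d \<Longrightarrow> norm (x s - x r) < e \<and> c - 1 < F (x s)"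
      unfolding eventually_at by auto
    have near: "x s \<in> C" if "r \<le> s" "s < r + d" for s
    proof (cases "s = r")
      case True
      thus ?thesis using xr sub by auto
    next
      case False
      with that r have "norm (x s - x r) < e \<and> c - 1 < F (x s)"
        by (intro d(2)) (auto simp: dist_real_def)
      moreover have "x s \<in> Sym" using that r by (intro xSym) simp
      ultimately show ?thesis using e(2) by (auto simp: C_def superlevel_def)
    qed
    \<comment> \<open>On this interval the closest-point map acts as the identity, so
      \<open>x\<close> follows the true gradient flow and \<open>F\<close> does not fall below its
      value at \<open>r\<close>. This improves membership in \<open>C\<close> to membership in
      \<open>C0\<close>.\<close>
    have after: "x s \<in> C0" if s: "r \<le> s" "s < r + d" for s
    proof -
      have "F (x r) \<le> F (x s)"
      proof (rule has_real_derivative_nonneg_imp_le[OF r s(1)])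
        fix u assume u: "r \<le> u" "u \<le> s"
        hence uC: "x u \<in> C" using s by (intro near) auto
        hence "x u \<in> SPD" by (simp add: C_def superlevel_def)
        moreover have "(x has_vector_derivative gF (x u)) (at u within {0..})"
          using x[of u] u r uC by (simp add: f_def closest_point_self)
        ultimately show "((\<lambda>t. F (x t)) has_real_derivative gmet (grad (x u)) (gF (x u)))
            (at u within {0..})"
          by (rule has_real_derivative_entropy_along)
        show "0 \<le> gmet (grad (x u)) (gF (x u))"
          using metric_nonneg[of "gF (x u)"] by (simp add: gmet_gF tangent_proj_Sym)
      qed
      thus ?thesis using near[OF s] xrS(2) by (simp add: C_def C0_def superlevel_def)
    qed
    have "r + d \<le> Inf S"
    proof (rule cInf_greatest[OF ne])
      fix s assume s: "s \<in> S"
      hence "r \<le> s" unfolding r_def by (intro cInf_lower bdd)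
      with after[of s] s show "r + d \<le> s" by (force simp: S_def)
    qed
    hence "r + d \<le> r" by (simp add: r_def)
    thus False using d(1) by simp
  qed
  hence xC0: "x t \<in> SPD" "x t \<in> C" if "t \<ge> 0" for t
    using that sub by (auto simp: C0_def superlevel_def)
  have "flow_solution S0 S1 P0 x" unfolding flow_solution_def
  proof (intro conjI allI impI)
    fix t :: real assume t: "t \<ge> 0"
    show "x t \<in> SPD" using xC0 t by blast
    have "f (x t) = flow_field S0 S1 (x t)"
      using xC0[OF t] by (simp add: f_def closest_point_self flow_field_eq)
    thus "(x has_vector_derivative flow_field S0 S1 (x t)) (at t within {0..})"
      using x[OF t] by simp
  qed (rule x0)
  thus ?thesis by blast
qed

end

theorem theorem2p14:
  fixes S0 S1 :: "real^'n^'n"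
  assumes "S0 \<in> SPD" and "S1 \<in> SPD"
  shows "\<exists>Pinf\<in>SPD.
    (\<forall>Q. is_arg_max (lift_entropy S0 S1) (\<lambda>P. P \<in> SPD) Q \<longleftrightarrow> Q = Pinf) \<and>
    Pinf ** S0 ** Pinf = S1 \<and>
    (\<forall>P\<in>SPD. (\<exists>!V. sylvester S0 S1 P V) \<and>
       cone_grad S0 (lift_entropy S0 S1) P = flow_field S0 S1 P) \<and>
    (\<exists>\<alpha>>0. hess_bound S0 S1 \<alpha>) \<and>
    (\<forall>P0\<in>SPD.
       (\<exists>P. flow_solution S0 S1 P0 P) \<and>
       (\<forall>P. flow_solution S0 S1 P0 P \<longrightarrow>
          (P \<longlongrightarrow> Pinf) at_top \<and>
          (\<forall>\<alpha>>0. hess_bound S0 S1 \<alpha> \<longrightarrow>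
             (\<forall>t\<ge>0.
                lift_entropy S0 S1 (P t) \<ge> exp (- 2 * \<alpha> * t) * lift_entropy S0 S1 P0 \<and>
                (lift_dist S0 (P t) Pinf)\<^sup>2
                  \<le> exp (- 2 * \<alpha> * t) * (lift_dist S0 P0 Pinf)\<^sup>2))))"
proof -
  interpret spd_pair S0 S1 using assms by unfold_locales
  show ?thesis
  proof (intro bexI[of _ Pinf] conjI ballI allI impI)
    show "is_arg_max (lift_entropy S0 S1) (\<lambda>P. P \<in> SPD) Q \<longleftrightarrow> Q = Pinf" for Q
      by (rule is_arg_max_lift_entropy)
  qed (rule Pinf hess_bound_exists sylvester_unique cone_grad_eq_flow_field flow_exists
      flow_converges flow_entropy_estimate flow_distance_estimate; assumption)+
qed

end
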